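(* Let $G$ be a planar graph with girth at least $6$ and maximum degree $\Delta \ge 4$. Then $$\chi_s'(G) \le 3\Delta + 6 .$$
   Context: All graphs are finite and simple. The girth of a graph is the length of a shortest cycle (taken to be $\infty$ if there is no cycle). The distance between two edges $e,e'$ of $G$ is the distance between the corresponding vertices in the line graph $L(G)$. A strong edge coloring of $G$ is a coloring of the edges in which any two distinct edges at distance at most two receive distinct colors (that is, two distinct edges that share an endpoint, or are both adjacent to a common edge, get different colors; equivalently, every color class is an induced matching). The strong chromatic index $\chi_s'(G)$ is the smallest number of colors in a strong edge coloring of $G$. *)

theory Defs
  imports "HOL-Analysis.Analysis" "HOL-Library.Extended_Nat"
begin

(* A graph is given by its vertex set V and its set E of edges, an edge being the
   two-element set of its endpoints; so there are no loops and no parallel edges. *)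
definition simple_graph :: "'a set \<Rightarrow> 'a set set \<Rightarrow> bool" where
  "simple_graph V E \<longleftrightarrow> finite V \<and> (\<forall>e\<in>E. e \<subseteq> V \<and> card e = 2)"

definition vertex_degree :: "'a set set \<Rightarrow> 'a \<Rightarrow> nat" where
  "vertex_degree E v = card {e \<in> E. v \<in> e}"

(* Inserting 0 only matters for the graph without vertices. *)
definition max_degree :: "'a set \<Rightarrow> 'a set set \<Rightarrow> nat" where
  "max_degree V E = Max (insert 0 (vertex_degree E ` V))"

(* A cycle is listed without repeating its first vertex, so its length is the length of the list. *)
definition is_cycle :: "'a set \<Rightarrow> 'a set set \<Rightarrow> 'a list \<Rightarrow> bool" where
  "is_cycle V E c \<longleftrightarrow> length c \<ge> 3 \<and> distinct c \<and> set c \<subseteq> V \<and>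
     successively (\<lambda>x y. {x, y} \<in> E) c \<and> {last c, hd c} \<in> E"

(* The infimum of the empty set in enat is infinity, as wanted for forests
   (and, for graph_dist, for vertices in different components). *)
definition girth :: "'a set \<Rightarrow> 'a set set \<Rightarrow> enat" where
  "girth V E = Inf {enat (length c) |c. is_cycle V E c}"

definition is_walk :: "'a set \<Rightarrow> 'a set set \<Rightarrow> 'a \<Rightarrow> 'a list \<Rightarrow> 'a \<Rightarrow> bool" where
  "is_walk V E u p v \<longleftrightarrow> p \<noteq> [] \<and> hd p = u \<and> last p = v \<and> set p \<subseteq> V \<and>
     successively (\<lambda>x y. {x, y} \<in> E) p"

definition graph_dist :: "'a set \<Rightarrow> 'a set set \<Rightarrow> 'a \<Rightarrow> 'a \<Rightarrow> enat" where
  "graph_dist V E u v = Inf {enat (length p - 1) |p. is_walk V E u p v}"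

(* The line graph of (V, E) is the graph (E, line_edges E). *)
definition line_edges :: "'a set set \<Rightarrow> 'a set set set" where
  "line_edges E = {{e, f} |e f. e \<in> E \<and> f \<in> E \<and> e \<noteq> f \<and> e \<inter> f \<noteq> {}}"

definition edge_dist :: "'a set set \<Rightarrow> 'a set \<Rightarrow> 'a set \<Rightarrow> enat" where
  "edge_dist E e f = graph_dist E (line_edges E) e f"

definition strong_edge_coloring :: "'a set set \<Rightarrow> ('a set \<Rightarrow> 'c) \<Rightarrow> bool" where
  "strong_edge_coloring E col \<longleftrightarrow>
     (\<forall>e\<in>E. \<forall>f\<in>E. e \<noteq> f \<and> edge_dist E e f \<le> 2 \<longrightarrow> col e \<noteq> col f)"

definition strong_chromatic_index :: "'a set set \<Rightarrow> nat" where
  "strong_chromatic_index E =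
     (LEAST k. \<exists>col :: 'a set \<Rightarrow> nat. strong_edge_coloring E col \<and> col ` E \<subseteq> {..<k})"

(* A drawing in the plane without crossings: pos places the vertices, arcs draws each edge as
   a simple arc between its endpoints that avoids all other vertices, and two such arcs meet
   only in common endpoints. The plane is the type complex, on which the library states
   the Jordan curve theorem. *)
definition plane_drawing ::
  "'a set \<Rightarrow> 'a set set \<Rightarrow> ('a \<Rightarrow> complex) \<Rightarrow> ('a set \<Rightarrow> real \<Rightarrow> complex) \<Rightarrow> bool" where
  "plane_drawing V E pos arcs \<longleftrightarrow>
     inj_on pos V \<and>
     (\<forall>e\<in>E. arc (arcs e) \<and> {pathstart (arcs e), pathfinish (arcs e)} = pos ` e \<and>
              path_image (arcs e) \<inter> pos ` V = pos ` e) \<and>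
     (\<forall>e\<in>E. \<forall>f\<in>E. e \<noteq> f \<longrightarrow> path_image (arcs e) \<inter> path_image (arcs f) = pos ` (e \<inter> f))"

definition planar :: "'a set \<Rightarrow> 'a set set \<Rightarrow> bool" where
  "planar V E \<longleftrightarrow> (\<exists>pos arcs. plane_drawing V E pos arcs)"

end

(* Two ingredients. First, in a planar graph of girth at least 6 every nonempty vertex set W
   spans fewer than 3|W|/2 edges. This is Euler's inequality, obtained directly from the drawing:
   every edge outside a maximal forest adds a face (by the dual of Janiszewski's theorem), a face
   cannot be bordered by a forest only, hence is bordered by at least 6 edges, and every edge
   borders at most two faces. The last fact is a homotopy argument: if p1, p2, p3 lie in three
   components of the complement of S \<union> A but in one component of the complement of S, the quotients
   (z - p1)/(z - p3) and (z - p2)/(z - p3) have logarithms on S and on the arc A, and some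
   nontrivial product of their powers has a logarithm on S \<union> A.

   Second, induction on the number of edges. Call an edge free if it conflicts with at most
   3 \<Delta> + 5 others, and easy if it conflicts with at most 3 \<Delta> + 5 edges that are not free. If all
   edges at a vertex v are easy, color G - v, uncolor the free edges, and greedily color first the
   edges at v that are not free and then the free ones. If there is no such v, delete the leaves
   of G; discharging onto the vertices of degree 2 shows that the remaining graph has average
   degree at least 3, which contradicts sparsity. *)
theory Submission
  imports Defs
begin

section \<open>Splitting components of the complement of a plane set\<close>

text \<open>Sparsity says that the sum of (degree - 3) over any spanned subgraph is negative, so 3
  is the balance point of the discharging and a vertex of degree 2 lacks a charge of 1. Asking both
  of its neighbors for 1/2 fails at neighbors that cannot afford it: those of degree 2 or 3, whose
  charge is at most 0, and those of degree 4 with at least three neighbors of degree 2, whose charge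
  1 is less than 3/2. If one neighbor is of this kind, the other has to pay 1. Counting all
  conflicts is too coarse to show that it can, since each neighbor of degree 2 then costs two edges.
  But the edges from these poor vertices to vertices of degree 2 turn out to be free, so once free
  edges are left out of the count, a neighbor that is paid 1 costs only one edge.\<close>

lemma log_quotient_same_component:
  fixes S :: "complex set"
  assumes "compact S" "connected_component (- S) p q"
  obtains h where "continuous_on S h" "\<And>z. z \<in> S \<Longrightarrow> (z - p) / (z - q) = exp (h z)"
proof -
  have pq: "p \<notin> S" "q \<notin> S"
    using assms(2) connected_component_in by (metis ComplD)+
  \<comment> \<open>The maps z -> (z - p) / |z - p| and z -> (z - q) / |z - q| into the circle are
    homotopic on \<open>S\<close> because \<open>p\<close> and \<open>q\<close> lie in one component
    of the complement, so their quotient has a logarithm i * h with \<open>h\<close> real. The real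
    part of \<open>?g\<close> restores the modulus.\<close>
  obtain h where conth: "continuous_on S h"
    and h: "\<And>x. x \<in> S \<Longrightarrow> exp (\<i> * of_real (h x)) = (x - p) /\<^sub>R cmod (x - p) / ((x - q) /\<^sub>R cmod (x - q))"
    using assms pq
    apply (simp add: Borsuk_maps_homotopic_in_connected_component_eq [symmetric])
    apply (subst (asm) homotopic_circlemaps_divide)
    apply (auto simp: inessential_eq_continuous_logarithm_circle)
    done
  let ?g = "\<lambda>z. \<i> * of_real (h z) + of_real (ln (cmod (z - p) / cmod (z - q)))"
  show thesis
  proof
    show "continuous_on S ?g"
      using pq by (intro continuous_intros conth) auto
    fix z assume z: "z \<in> S"
    then have nz: "z \<noteq> p" "z \<noteq> q" using pq by auto
    have "complex_of_real (cmod (z - p)) \<noteq> 0" "complex_of_real (cmod (z - q)) \<noteq> 0"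
      using nz by auto
    note nz = this nz
    have "exp (complex_of_real (ln (cmod (z - p) / cmod (z - q)))) = of_real (cmod (z - p) / cmod (z - q) :: real)"
      using nz unfolding exp_of_real by simp
    then have "exp (?g z) = (z - p) /\<^sub>R cmod (z - p) / ((z - q) /\<^sub>R cmod (z - q)) * of_real (cmod (z - p) / cmod (z - q))"
      by (simp only: exp_add h[OF z])
    also have "\<dots> = (z - p) / (z - q)"
      using nz by (simp add: scaleR_conv_of_real divide_simps)
    finally show "(z - p) / (z - q) = exp (?g z)" ..
  qed
qed

text \<open>On the frontier of \<open>c\<close> the two formulas agree, so (z - p)^m outside
  \<open>c\<close> continues into \<open>c\<close> as the nonvanishing function g * exp L. The glued
  function has a logarithm on the whole plane, yet on a large circle around \<open>p\<close> it is
  (z - p)^m, which winds m times around 0.\<close>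

lemma no_log_of_power_bounded_component:
  fixes K c :: "complex set" and m :: int
  assumes K: "compact K" and c: "c \<in> components (- K)" "bounded c" and p: "p \<in> c" and m: "m \<noteq> 0"
    and g: "continuous_on (closure c) g" "\<And>z. z \<in> closure c \<Longrightarrow> g z \<noteq> 0"
    and L: "continuous_on K L"
    and eq: "\<And>z. z \<in> frontier c \<Longrightarrow> (z - p) powi m = g z * exp (L z)"
  shows False
proof -
  have "open c" using open_components[OF open_Compl[OF compact_imp_closed[OF K]] c(1)] .
  have fK: "frontier c \<subseteq> K"
    using frontier_of_components_closed_complement[of K c] K c(1) compact_imp_closed by auto
  \<comment> \<open>\<open>L\<close> is given only on \<open>K\<close>, which is disjoint from
    \<open>c\<close>. Any continuous extension into \<open>c\<close> serves, since
    \<open>exp\<close> has no zeros.\<close>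
  obtain L' where L': "continuous_on UNIV L'" "\<And>z. z \<in> K \<Longrightarrow> L' z = L z"
    using Tietze_unbounded[OF L, of UNIV] K by (auto simp: compact_imp_closed)
  define G where "G = (\<lambda>z. if z \<in> closure c then g z * exp (L' z) else (z - p) powi m)"
  have "continuous_on (closure c \<union> - c) G"
    unfolding G_def
  proof (rule continuous_on_cases)
    show "closed (- c)" using \<open>open c\<close> by auto
    show "continuous_on (closure c) (\<lambda>z. g z * exp (L' z))"
      by (intro continuous_intros g continuous_on_subset[OF L'(1)]) auto
    show "continuous_on (- c) (\<lambda>z. (z - p) powi m)"
      using p by (intro continuous_intros) auto
    have "closure c \<inter> - c = frontier c"
      using \<open>open c\<close> by (auto simp: frontier_def interior_open)
    then show "\<forall>x. x \<in> closure c \<and> x \<notin> closure c \<or> x \<in> - c \<and> x \<in> closure c \<longrightarrow>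
        g x * exp (L' x) = (x - p) powi m"
      using eq fK L'(2) by (metis ComplI IntI subsetD)
  qed auto
  moreover have "closure c \<union> - c = UNIV" using closure_subset by auto
  ultimately have contG: "continuous_on UNIV G" by simp
  have "G z \<noteq> 0" for z
    using g(2) p closure_subset by (auto simp: G_def power_int_eq_0_iff)
  then obtain \<psi> where \<psi>: "continuous_on UNIV \<psi>" "\<And>z. G z = exp (\<psi> z)"
    using continuous_logarithm_on_contractible[OF contG contractible_UNIV] by auto
  obtain R0 where R0: "R0 > 0" and "c \<subseteq> ball p R0"
    using bounded_subset_ballD[OF c(2)] by blast
  then have "c \<subseteq> cball p R0" using ball_subset_cball by blast
  then have cR: "closure c \<subseteq> cball p R0" by (simp add: closure_minimal)
  define R where "R = R0 + 1"
  have R: "R > 0" "R > R0" using R0 by (auto simp: R_def)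
  define w where "w = (\<lambda>t::real. p + of_real R * exp (\<i> * of_real t))"
  \<comment> \<open>\<open>u\<close> compares the logarithm \<open>\<psi>\<close> along the circle
    with the explicit one, m * (i t + ln R). Its values are integer multiples of 2 pi i, so it is
    constant, while the explicit logarithm gains 2 pi i m in one turn.\<close>
  define u where "u = (\<lambda>t::real. \<psi> (w t) - of_int m * (\<i> * of_real t) - of_int m * of_real (ln R))"
  have eu: "exp (u t) = 1" for t
  proof -
    have "w t \<notin> closure c"
    proof -
      have "dist p (w t) = R" using R by (simp add: w_def dist_norm norm_mult)
      then show ?thesis using cR R by (metis linorder_not_less mem_cball subsetD)
    qed
    then have "exp (\<psi> (w t)) = (of_real R * exp (\<i> * of_real t)) powi m"
      using \<psi>(2)[of "w t"] by (simp add: G_def w_def)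
    also have "of_real R * exp (\<i> * of_real t) = exp (\<i> * of_real t + of_real (ln R))"
      using R unfolding exp_add exp_of_real by simp
    also have "(\<dots>) powi m = exp (of_int m * (\<i> * of_real t + of_real (ln R)))"
      by (rule exp_power_int)
    finally have "exp (\<psi> (w t)) = exp (of_int m * (\<i> * of_real t) + of_int m * of_real (ln R))"
      by (simp only: distrib_left)
    then show ?thesis
      by (simp only: u_def diff_diff_eq exp_diff) simp
  qed
  have "continuous_on {0..2*pi} u"
  proof -
    have "continuous_on {0..2*pi} w"
      unfolding w_def by (intro continuous_intros)
    then have "continuous_on {0..2*pi} (\<lambda>t. \<psi> (w t))"
      by (rule continuous_on_compose2[OF \<psi>(1)]) auto
    then show ?thesis unfolding u_def by (intro continuous_intros)
  qed
  then have "u constant_on {0..2*pi}"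
  proof (rule continuous_discrete_range_constant[rotated])
    fix x assume "x \<in> {0..2*pi}"
    show "\<exists>e>0. \<forall>y. y \<in> {0..2*pi} \<and> u y \<noteq> u x \<longrightarrow> e \<le> cmod (u y - u x)"
    proof (intro exI[of _ 1] conjI allI impI)
      fix y assume y: "y \<in> {0..2*pi} \<and> u y \<noteq> u x"
      show "1 \<le> cmod (u y - u x)"
      proof (rule ccontr)
        assume "\<not> ?thesis"
        then have "\<bar>Im (u y) - Im (u x)\<bar> < 1"
          using abs_Im_le_cmod[of "u y - u x"] by simp
        then have "\<bar>Im (u y) - Im (u x)\<bar> < 2 * pi" using pi_gt3 by linarith
        then have "u y = u x" by (rule exp_complex_eqI) (simp only: eu)
        with y show False by simp
      qed
    qed auto
  qed auto
  moreover have "2*pi \<in> {0..2*pi}" "0 \<in> {0..2*pi}" by auto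
  ultimately have "u (2*pi) = u 0" unfolding constant_on_def by metis
  moreover have "w (2*pi) = w 0" using exp_two_pi_i by (simp add: w_def mult_ac)
  ultimately have "of_int m * (\<i> * of_real (2 * pi)) = 0" by (simp only: u_def) simp
  then show False using m by simp
qed

text \<open>Each quotient has a logarithm on \<open>S\<close> and one on \<open>A\<close>; at a
  point of \<open>S \<inter> A\<close> the two differ by a multiple of 2 pi i. Gluing needs the same
  multiple at both points, which is one linear equation. For a single quotient it may force the
  exponent 0; two quotients, hence three points, leave a nontrivial integer solution.\<close>

lemma log_power_product_union:
  fixes S A :: "complex set"
  assumes S: "compact S" and A: "compact A" "contractible A" and SA: "S \<inter> A \<subseteq> {a, b}"
    and con: "connected_component (- S) p1 p3" "connected_component (- S) p2 p3"
    and notA: "p1 \<notin> A" "p2 \<notin> A" "p3 \<notin> A"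
  obtains m1 m2 :: int and L where "m1 \<noteq> 0 \<or> m2 \<noteq> 0" "continuous_on (S \<union> A) L"
    "\<And>z. z \<in> S \<union> A \<Longrightarrow> ((z - p1) / (z - p3)) powi m1 * ((z - p2) / (z - p3)) powi m2 = exp (L z)"
proof -
  let ?r = "\<lambda>z. (z - p1) / (z - p3)" and ?s = "\<lambda>z. (z - p2) / (z - p3)"
  have notS: "p1 \<notin> S" "p2 \<notin> S" "p3 \<notin> S"
    using con connected_component_in by (metis ComplD)+
  obtain h1 where h1: "continuous_on S h1" "\<And>z. z \<in> S \<Longrightarrow> ?r z = exp (h1 z)"
    using log_quotient_same_component[OF S con(1)] by metis
  obtain h2 where h2: "continuous_on S h2" "\<And>z. z \<in> S \<Longrightarrow> ?s z = exp (h2 z)"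
    using log_quotient_same_component[OF S con(2)] by metis
  have contr: "continuous_on A ?r" and conts: "continuous_on A ?s"
    using notA by (auto intro!: continuous_intros)
  obtain k1 where k1: "continuous_on A k1" "\<And>z. z \<in> A \<Longrightarrow> ?r z = exp (k1 z)"
    by (rule continuous_logarithm_on_contractible[OF contr A(2)]) (use notA in auto)
  obtain k2 where k2: "continuous_on A k2" "\<And>z. z \<in> A \<Longrightarrow> ?s z = exp (k2 z)"
    by (rule continuous_logarithm_on_contractible[OF conts A(2)]) (use notA in auto)
  have d1: "\<exists>n::int. h1 z - k1 z = of_int (2 * n) * (of_real pi * \<i>)" if "z \<in> S \<inter> A" for z
  proof -
    have "exp (h1 z) = exp (k1 z)" using that h1(2)[of z] k1(2)[of z] by (metis IntE)
    then show ?thesis unfolding exp_eq by (auto simp: algebra_simps)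
  qed
  have d2: "\<exists>n::int. h2 z - k2 z = of_int (2 * n) * (of_real pi * \<i>)" if "z \<in> S \<inter> A" for z
  proof -
    have "exp (h2 z) = exp (k2 z)" using that h2(2)[of z] k2(2)[of z] by (metis IntE)
    then show ?thesis unfolding exp_eq by (auto simp: algebra_simps)
  qed
  have "\<exists>(m1::int) (m2::int) (N::int). (m1 \<noteq> 0 \<or> m2 \<noteq> 0) \<and>
      (\<forall>z\<in>S \<inter> A. of_int m1 * h1 z + of_int m2 * h2 z =
        of_int m1 * k1 z + of_int m2 * k2 z + of_int (2 * N) * (of_real pi * \<i>))"
  proof (cases "S \<inter> A = {}")
    case True
    then show ?thesis by (intro exI[of _ 1]) auto
  next
    case False
    \<comment> \<open>Here \<open>x = y\<close> is possible: \<open>S\<close> and \<open>A\<close>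
      may meet in a single point.\<close>
    then obtain x y where xy: "S \<inter> A = {x, y}" using SA by blast
    obtain n1x n1y n2x n2y where n:
      "h1 x - k1 x = of_int (2 * n1x) * (of_real pi * \<i>)"
      "h1 y - k1 y = of_int (2 * n1y) * (of_real pi * \<i>)"
      "h2 x - k2 x = of_int (2 * n2x) * (of_real pi * \<i>)"
      "h2 y - k2 y = of_int (2 * n2y) * (of_real pi * \<i>)"
      using d1[of x] d1[of y] d2[of x] d2[of y] xy by blast
    have n': "h1 x = k1 x + of_int (2 * n1x) * (of_real pi * \<i>)"
      "h1 y = k1 y + of_int (2 * n1y) * (of_real pi * \<i>)"
      "h2 x = k2 x + of_int (2 * n2x) * (of_real pi * \<i>)"
      "h2 y = k2 y + of_int (2 * n2y) * (of_real pi * \<i>)"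
      using n by (metis add.commute diff_add_cancel)+
    \<comment> \<open>\<open>e1\<close> and \<open>e2\<close> say how much the discrepancy of each
      quotient changes from \<open>x\<close> to \<open>y\<close>; the exponents (e2, -e1) cancel
      these changes.\<close>
    define e1 e2 where e: "e1 = n1y - n1x" "e2 = n2y - n2x"
    obtain m1 m2 :: int where m: "m1 \<noteq> 0 \<or> m2 \<noteq> 0" "m1 * e1 + m2 * e2 = 0"
    proof (cases "e1 = 0 \<and> e2 = 0")
      case True then show ?thesis using that[of 1 0] by simp
    next
      case False then show ?thesis using that[of e2 "- e1"] by auto
    qed
    have N: "m1 * n1y + m2 * n2y = m1 * n1x + m2 * n2x"
      using m(2) by (simp add: e algebra_simps)
    have x: "of_int m1 * h1 x + of_int m2 * h2 x =
        of_int m1 * k1 x + of_int m2 * k2 x + of_int (2 * (m1 * n1x + m2 * n2x)) * (of_real pi * \<i>)"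
      by (simp add: n' algebra_simps)
    have y: "of_int m1 * h1 y + of_int m2 * h2 y =
        of_int m1 * k1 y + of_int m2 * k2 y + of_int (2 * (m1 * n1x + m2 * n2x)) * (of_real pi * \<i>)"
      unfolding N[symmetric] by (simp add: n' algebra_simps)
    show ?thesis using m(1) x y unfolding xy by blast
  qed
  then obtain m1 m2 N :: int where m: "m1 \<noteq> 0 \<or> m2 \<noteq> 0"
    and N: "\<And>z. z \<in> S \<inter> A \<Longrightarrow> of_int m1 * h1 z + of_int m2 * h2 z =
        of_int m1 * k1 z + of_int m2 * k2 z + of_int (2 * N) * (of_real pi * \<i>)"
    by blast
  define L where "L = (\<lambda>z. if z \<in> S then of_int m1 * h1 z + of_int m2 * h2 z
    else of_int m1 * k1 z + of_int m2 * k2 z + of_int (2 * N) * (of_real pi * \<i>))"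
  show thesis
  proof
    show "continuous_on (S \<union> A) L"
      unfolding L_def using S A h1(1) h2(1) k1(1) k2(1) N
      by (intro continuous_on_cases) (auto simp: compact_imp_closed intro!: continuous_intros)
    fix z assume z: "z \<in> S \<union> A"
    show "?r z powi m1 * ?s z powi m2 = exp (L z)"
    proof (cases "z \<in> S")
      case True
      then have "?r z powi m1 * ?s z powi m2 = exp (h1 z) powi m1 * exp (h2 z) powi m2"
        using h1(2) h2(2) by simp
      also have "\<dots> = exp (of_int m1 * h1 z) * exp (of_int m2 * h2 z)"
        by (simp add: exp_power_int)
      finally show ?thesis using True by (simp add: L_def exp_add)
    next
      case False
      with z have zA: "z \<in> A" by simp
      have "?r z powi m1 * ?s z powi m2 = exp (k1 z) powi m1 * exp (k2 z) powi m2"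
        using k1(2)[OF zA] k2(2)[OF zA] by simp
      also have "\<dots> = exp (of_int m1 * k1 z) * exp (of_int m2 * k2 z)"
        by (simp add: exp_power_int)
      also have "\<dots> = exp (L z)"
      proof -
        have "exp (of_int (2 * N) * (of_real pi * \<i>)) = 1"
          using exp_integer_2pi[of "of_int N"] by (simp add: mult_ac)
        then show ?thesis using False by (simp add: L_def exp_add)
      qed
      finally show ?thesis .
    qed
  qed (rule m)
qed

text \<open>The product of powers has order m1 at \<open>p1\<close>, m2 at \<open>p2\<close> and
  -(m1 + m2) at \<open>p3\<close>. If the three components were distinct, every nonzero order would
  force its component to be unbounded, by \<open>no_log_of_power_bounded_component\<close>. But at
  most one of the orders is 0, and at most one component is unbounded.\<close>

lemma arc_splits_component_in_two:
  fixes S A :: "complex set"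
  assumes S: "compact S" and A: "compact A" "contractible A" and SA: "S \<inter> A \<subseteq> {a, b}"
    and con: "connected_component (- S) p1 p3" "connected_component (- S) p2 p3"
    and notA: "p1 \<notin> A" "p2 \<notin> A" "p3 \<notin> A"
  shows "connected_component (- (S \<union> A)) p1 p2 \<or> connected_component (- (S \<union> A)) p1 p3 \<or>
    connected_component (- (S \<union> A)) p2 p3"
proof (rule ccontr)
  assume neg: "\<not> ?thesis"
  let ?K = "S \<union> A"
  define C where "C = connected_component_set (- ?K)"
  have K: "compact ?K" using S A by auto
  have notS: "p1 \<notin> S" "p2 \<notin> S" "p3 \<notin> S"
    using con connected_component_in by (metis ComplD)+
  have pC: "p1 \<in> C p1" "p2 \<in> C p2" "p3 \<in> C p3"
    using notA notS by (auto simp: C_def connected_component_refl)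
  have comp: "C p1 \<in> components (- ?K)" "C p2 \<in> components (- ?K)" "C p3 \<in> components (- ?K)"
    using notA notS by (auto simp: C_def components_iff)
  have op: "open (C p)" for p
    unfolding C_def by (rule open_connected_component[OF open_Compl[OF compact_imp_closed[OF K]]])
  have disj: "C p1 \<inter> C p2 = {}" "C p1 \<inter> C p3 = {}" "C p2 \<inter> C p3 = {}"
    using neg notA notS by (auto simp: C_def connected_component_disjoint connected_component_sym_eq)
  then have ncl: "p2 \<notin> closure (C p1)" "p3 \<notin> closure (C p1)" "p1 \<notin> closure (C p2)"
      "p3 \<notin> closure (C p2)" "p1 \<notin> closure (C p3)" "p2 \<notin> closure (C p3)"
    using op pC open_Int_closure_eq_empty by (metis IntI Int_commute empty_iff)+
  have bd: "bounded (C p1) \<or> bounded (C p2)" "bounded (C p1) \<or> bounded (C p3)"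
      "bounded (C p2) \<or> bounded (C p3)"
    using cobounded_unique_unbounded_components[of "- ?K"] K comp disj pC
    by (metis DIM_complex compact_imp_bounded double_compl empty_iff inf.idem order_refl)+
  have fr: "frontier (C p1) \<subseteq> ?K" "frontier (C p2) \<subseteq> ?K" "frontier (C p3) \<subseteq> ?K"
    using frontier_of_components_closed_complement[of ?K] K comp compact_imp_closed by blast+
  obtain m1 m2 :: int and L where m: "m1 \<noteq> 0 \<or> m2 \<noteq> 0" and contL: "continuous_on ?K L"
    and L: "\<And>z. z \<in> ?K \<Longrightarrow> ((z - p1) / (z - p3)) powi m1 * ((z - p2) / (z - p3)) powi m2 = exp (L z)"
    using log_power_product_union[OF S A SA con notA] by metis
  have nz: "z - p1 \<noteq> 0" "z - p2 \<noteq> 0" "z - p3 \<noteq> 0" if "z \<in> ?K" for z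
    using that notA notS by auto
  have L': "(z - p1) powi m1 * (z - p2) powi m2 = (z - p3) powi (m1 + m2) * exp (L z)" if "z \<in> ?K" for z
    unfolding L[OF that, symmetric] using nz[OF that]
    by (simp add: power_int_divide_distrib power_int_add)
  note core = no_log_of_power_bounded_component[OF K]
  \<comment> \<open>The factors other than the power of z - p1 have their zeros and poles at
    \<open>p2\<close> and \<open>p3\<close>, outside the closure of \<open>C p1\<close>, so they can
    serve as \<open>g\<close>.\<close>
  have b1: "\<not> bounded (C p1)" if "m1 \<noteq> 0"
  proof
    assume "bounded (C p1)"
    then show False
    proof (rule core[OF comp(1) _ pC(1) that _ _ contL,
          where g = "\<lambda>z. (z - p3) powi (m1 + m2) * (z - p2) powi (- m2)"])
      show "continuous_on (closure (C p1)) (\<lambda>z. (z - p3) powi (m1 + m2) * (z - p2) powi (- m2))"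
        using ncl by (intro continuous_intros) auto
      show "(z - p3) powi (m1 + m2) * (z - p2) powi (- m2) \<noteq> 0" if "z \<in> closure (C p1)" for z
        using that ncl by (auto simp: power_int_eq_0_iff)
      show "(z - p1) powi m1 = (z - p3) powi (m1 + m2) * (z - p2) powi (- m2) * exp (L z)"
        if "z \<in> frontier (C p1)" for z
      proof -
        have "z \<in> ?K" using that fr by blast
        then show ?thesis using L'[of z] nz[of z] by (simp add: power_int_minus field_simps)
      qed
    qed
  qed
  have b2: "\<not> bounded (C p2)" if "m2 \<noteq> 0"
  proof
    assume "bounded (C p2)"
    then show False
    proof (rule core[OF comp(2) _ pC(2) that _ _ contL,
          where g = "\<lambda>z. (z - p3) powi (m1 + m2) * (z - p1) powi (- m1)"])
      show "continuous_on (closure (C p2)) (\<lambda>z. (z - p3) powi (m1 + m2) * (z - p1) powi (- m1))"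
        using ncl by (intro continuous_intros) auto
      show "(z - p3) powi (m1 + m2) * (z - p1) powi (- m1) \<noteq> 0" if "z \<in> closure (C p2)" for z
        using that ncl by (auto simp: power_int_eq_0_iff)
      show "(z - p2) powi m2 = (z - p3) powi (m1 + m2) * (z - p1) powi (- m1) * exp (L z)"
        if "z \<in> frontier (C p2)" for z
      proof -
        have "z \<in> ?K" using that fr by blast
        then show ?thesis using L'[of z] nz[of z] by (simp add: power_int_minus field_simps)
      qed
    qed
  qed
  have b3: "\<not> bounded (C p3)" if "m1 + m2 \<noteq> 0"
  proof
    assume "bounded (C p3)"
    have cL: "continuous_on ?K (\<lambda>z. - L z)" by (intro continuous_intros contL)
    from \<open>bounded (C p3)\<close> show False
    proof (rule core[OF comp(3) _ pC(3) that _ _ cL,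
          where g = "\<lambda>z. (z - p1) powi m1 * (z - p2) powi m2"])
      show "continuous_on (closure (C p3)) (\<lambda>z. (z - p1) powi m1 * (z - p2) powi m2)"
        using ncl by (intro continuous_intros) auto
      show "(z - p1) powi m1 * (z - p2) powi m2 \<noteq> 0" if "z \<in> closure (C p3)" for z
        using that ncl by (auto simp: power_int_eq_0_iff)
      show "(z - p3) powi (m1 + m2) = (z - p1) powi m1 * (z - p2) powi m2 * exp (- L z)"
        if "z \<in> frontier (C p3)" for z
      proof -
        have "z \<in> ?K" using that fr by blast
        then show ?thesis using L'[of z] by (simp add: exp_minus field_simps)
      qed
    qed
  qed
  have "m1 + m2 \<noteq> 0 \<or> (m1 \<noteq> 0 \<and> m2 \<noteq> 0)" using m by presburger
  then show False using b1 b2 b3 bd m by metis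
qed

section \<open>Attaching an arc to a compact set\<close>

lemma connected_complement_Un:
  fixes S A :: "complex set"
  assumes "compact S" "closed A" "connected (- S)" "connected (- A)" "connected (S \<inter> A)"
  shows "connected (- (S \<union> A))"
  unfolding connected_iff_connected_component
proof (intro ballI)
  fix x y assume xy: "x \<in> - (S \<union> A)" "y \<in> - (S \<union> A)"
  have "connected_component (- S) x y" "connected_component (- A) x y"
    using assms(3,4) xy unfolding connected_iff_connected_component by auto
  with assms show "connected_component (- (S \<union> A)) x y" by (intro Janiszewski)
qed

lemma component_eq_connected_component_set:
  assumes "d \<in> components S" "z \<in> d"
  shows "connected_component_set S z = d"
proof -
  obtain x where x: "d = connected_component_set S x" using assms(1) by (auto elim: componentsE)
  show ?thesis using connected_component_eq[of z S x] assms(2) unfolding x .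
qed

text \<open>Each component of the new complement lies in one component of the old one, and this map
  \<open>r\<close> is onto because \<open>A\<close> has empty interior. It is not injective: by the
  dual of Janiszewski's theorem \<open>S0 \<union> A\<close> separates the plane, and both sides
  reach the component of \<open>- S\<close> that contains the open arc. Finiteness matters because
  \<open>card\<close> is 0 on infinite sets.\<close>

lemma card_components_add_arc:
  fixes S S0 A :: "complex set"
  assumes S: "compact S" and S0: "S0 \<subseteq> S" "compact S0" "connected S0" "connected (- S0)"
    and A: "compact A" "connected A" "interior A = {}"
    and SA: "S \<inter> A = {a, b}" "a \<in> S0" "b \<in> S0" "a \<noteq> b"
    and I: "connected (A - {a, b})"
    and fin: "finite (components (- (S \<union> A)))"
  shows "card (components (- S)) < card (components (- (S \<union> A)))"
proof -
  let ?I = "A - {a, b}"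
  have "?I \<noteq> {}"
  proof
    assume "?I = {}"
    then have "A = {a, b}" using SA by auto
    then show False using A(2) SA(4) connected_finite_iff_sing[of A] by auto
  qed
  then obtain x where x: "x \<in> ?I" by blast
  have IS: "?I \<subseteq> - S" using SA by blast
  define f where "f = connected_component_set (- S) x"
  have opf: "open f" unfolding f_def
    by (rule open_connected_component[OF open_Compl[OF compact_imp_closed[OF S]]])
  have If: "?I \<subseteq> f" unfolding f_def
    by (rule connected_component_maximal[OF x I IS])
  have fS: "f \<subseteq> - S" unfolding f_def by (rule connected_component_subset)
  have op0: "open (- (S0 \<union> A))" using S0 A by (auto intro!: open_Compl compact_imp_closed)
  have "S0 \<inter> A = {a, b}" using SA S0 by blast
  moreover have "\<not> connected {a, b}"
    using SA(4) connected_finite_iff_sing[of "{a, b}"] by auto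
  ultimately have "\<not> connected (- (S0 \<union> A))"
    using Janiszewski_dual[OF S0(2) A(1) S0(3) A(2)] by metis
  then obtain u0 w0 where uw0: "u0 \<in> - (S0 \<union> A)" "w0 \<in> - (S0 \<union> A)"
      "\<not> connected_component (- (S0 \<union> A)) u0 w0"
    unfolding connected_iff_connected_component by blast
  \<comment> \<open>If the frontier of \<open>U\<close> avoided the open arc, it would lie in
    \<open>S0\<close>, although the connected set \<open>- S0\<close> has points inside and outside
    \<open>U\<close>. A frontier point on the open arc lies in the open set \<open>f\<close>, so
    \<open>U\<close> meets \<open>f\<close>.\<close>
  have meets: "\<exists>v \<in> f - A. connected_component (- (S0 \<union> A)) u v" if u: "u \<in> - (S0 \<union> A)" for u
  proof -
    define U where "U = connected_component_set (- (S0 \<union> A)) u"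
    have Uc: "U \<in> components (- (S0 \<union> A))" using u by (auto simp: U_def components_iff)
    have uU: "u \<in> U" using u by (auto simp: U_def connected_component_refl)
    have Usub: "U \<subseteq> - (S0 \<union> A)" unfolding U_def by (rule connected_component_subset)
    have opU: "open U" using open_components[OF op0 Uc] .
    have fr: "frontier U \<subseteq> S0 \<union> A"
      by (rule frontier_of_components_closed_complement[OF _ Uc]) (intro closed_Un compact_imp_closed S0 A)
    have "frontier U \<inter> ?I \<noteq> {}"
    proof
      assume "frontier U \<inter> ?I = {}"
      then have frS0: "frontier U \<subseteq> S0" using fr SA by blast
      have "x \<in> - S0" using x IS S0 by blast
      have "- S0 \<inter> frontier U \<noteq> {}"
      proof (rule connected_Int_frontier[OF S0(4)])
        show "- S0 \<inter> U \<noteq> {}" using uU Usub by blast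
        show "- S0 - U \<noteq> {}" using x \<open>x \<in> - S0\<close> Usub by blast
      qed
      with frS0 show False by blast
    qed
    then obtain y where y: "y \<in> frontier U" "y \<in> ?I" by blast
    have "y \<in> closure U" using y by (simp add: frontier_def)
    then have "f \<inter> U \<noteq> {}"
      using open_Int_closure_eq_empty[OF opf, of U] y(2) If by blast
    then show ?thesis using Usub by (auto simp: U_def)
  qed
  obtain u where u: "u \<in> f - A" "connected_component (- (S0 \<union> A)) u0 u" using meets[OF uw0(1)] by blast
  obtain w where w: "w \<in> f - A" "connected_component (- (S0 \<union> A)) w0 w" using meets[OF uw0(2)] by blast
  let ?C = "components (- (S \<union> A))"
  let ?K = "connected_component_set (- (S \<union> A))"
  define r where "r = (\<lambda>d. connected_component_set (- S) (SOME z. z \<in> d))"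
  have r: "r d = connected_component_set (- S) z" if "d \<in> ?C" "z \<in> d" for d z
  proof -
    have "(SOME z. z \<in> d) \<in> d" using that(2) by (rule someI)
    moreover have "d \<subseteq> - S" "connected d"
      using that(1) in_components_subset in_components_connected by fastforce+
    ultimately have "connected_component (- S) (SOME z. z \<in> d) z"
      unfolding connected_component_def using that(2) by blast
    then have "z \<in> connected_component_set (- S) (SOME z. z \<in> d)" by simp
    then show ?thesis unfolding r_def by (rule connected_component_eq[symmetric])
  qed
  have "u \<in> - (S \<union> A)" "w \<in> - (S \<union> A)"
    using u(1) w(1) fS by blast+
  then have K: "?K u \<in> ?C" "u \<in> ?K u" "?K w \<in> ?C" "w \<in> ?K w"
    by (blast intro: componentsI connected_component_refl)+
  have "?K u \<noteq> ?K w"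
  proof
    assume "?K u = ?K w"
    then have "connected_component (- (S \<union> A)) u w" using K(4) by (metis mem_Collect_eq)
    then have "connected_component (- (S0 \<union> A)) u w"
      by (rule connected_component_of_subset) (use S0 in auto)
    then show False
      using u(2) w(2) uw0(3) by (meson connected_component_sym connected_component_trans)
  qed
  moreover have "r (?K u) = r (?K w)"
  proof -
    have "connected_component_set (- S) u = f" "connected_component_set (- S) w = f"
      using u(1) w(1) connected_component_eq[of _ "- S" x] unfolding f_def by blast+
    then show ?thesis using r[OF K(1,2)] r[OF K(3,4)] by argo
  qed
  ultimately have ninj: "\<not> inj_on r ?C" using K by (meson inj_onD)
  have "components (- S) = r ` ?C"
  proof (intro equalityI subsetI)
    fix c assume c: "c \<in> components (- S)"
    have "open c" using open_components[OF open_Compl[OF compact_imp_closed[OF S]] c] .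
    moreover have "c \<noteq> {}" using c in_components_nonempty by blast
    ultimately have "\<not> c \<subseteq> A" using A(3) interior_maximal by blast
    then obtain z where z: "z \<in> c" "z \<notin> A" by blast
    then have "z \<in> - (S \<union> A)" using c in_components_subset by blast
    then have "?K z \<in> ?C" "z \<in> ?K z" by (blast intro: componentsI connected_component_refl)+
    moreover have "r (?K z) = c"
      using r[OF calculation] component_eq_connected_component_set[OF c z(1)] by simp
    ultimately show "c \<in> r ` ?C" by blast
  next
    fix c assume "c \<in> r ` ?C"
    then obtain d where d: "d \<in> ?C" "c = r d" by blast
    then obtain z where "z \<in> d" using in_components_nonempty by blast
    moreover have "z \<in> - S" using calculation d(1) in_components_subset by fastforce
    ultimately show "c \<in> components (- S)" using r[OF d(1)] d(2) by (metis componentsI)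
  qed
  then have "card (components (- S)) = card (r ` ?C)" by simp
  also have "\<dots> < card ?C"
    using ninj fin card_image_le[OF fin, of r] eq_card_imp_inj_on[OF fin, of r] by linarith
  finally show ?thesis .
qed

text \<open>A component whose frontier contains a point of the open arc can be joined to that point
  inside \<open>- S\<close>. So all such components lie in the one component of \<open>- S\<close>
  around the open arc, and \<open>arc_splits_component_in_two\<close> applies to a point of
  each.\<close>

lemma arc_borders_two_components:
  fixes S A :: "complex set"
  assumes S: "compact S" and A: "compact A" "contractible A" and SA: "S \<inter> A \<subseteq> {a, b}"
    and I: "connected (A - {a, b})"
    and f: "f1 \<in> components (- (S \<union> A))" "f2 \<in> components (- (S \<union> A))" "f3 \<in> components (- (S \<union> A))"
    and fr: "frontier f1 \<inter> (A - {a, b}) \<noteq> {}" "frontier f2 \<inter> (A - {a, b}) \<noteq> {}"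
      "frontier f3 \<inter> (A - {a, b}) \<noteq> {}"
  shows "f1 = f2 \<or> f1 = f3 \<or> f2 = f3"
proof -
  let ?I = "A - {a, b}"
  have IS: "?I \<subseteq> - S" using SA by blast
  obtain x where x: "x \<in> ?I" using fr by blast
  have *: "\<exists>p \<in> g. p \<notin> A \<and> connected_component (- S) p x"
    if g: "g \<in> components (- (S \<union> A))" "frontier g \<inter> ?I \<noteq> {}" for g
  proof -
    obtain y where y: "y \<in> frontier g" "y \<in> ?I" using g by blast
    obtain p where p: "p \<in> g" using g in_components_nonempty by blast
    have gS: "g \<subseteq> - (S \<union> A)" using g in_components_subset by blast
    have "connected (insert y g)"
    proof (rule connected_intermediate_closure)
      show "connected g" using g in_components_connected by blast
      show "insert y g \<subseteq> closure g" using y closure_subset by (auto simp: frontier_def)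
    qed auto
    moreover have "insert y g \<subseteq> - S" using gS y IS by blast
    ultimately have "connected_component (- S) p y" unfolding connected_component_def using p by blast
    moreover have "connected_component (- S) y x"
      unfolding connected_component_def using I IS x y(2) by blast
    ultimately show ?thesis using p gS by (meson ComplD UnI2 connected_component_trans subsetD)
  qed
  obtain p1 where p1: "p1 \<in> f1" "p1 \<notin> A" "connected_component (- S) p1 x" using *[OF f(1) fr(1)] by blast
  obtain p2 where p2: "p2 \<in> f2" "p2 \<notin> A" "connected_component (- S) p2 x" using *[OF f(2) fr(2)] by blast
  obtain p3 where p3: "p3 \<in> f3" "p3 \<notin> A" "connected_component (- S) p3 x" using *[OF f(3) fr(3)] by blast
  have "connected_component (- S) p1 p3" "connected_component (- S) p2 p3"
    using p1 p2 p3 by (meson connected_component_sym connected_component_trans)+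
  from arc_splits_component_in_two[OF S A SA this p1(2) p2(2) p3(2)]
  have "p1 \<in> connected_component_set (- (S \<union> A)) p2 \<or> p1 \<in> connected_component_set (- (S \<union> A)) p3 \<or>
      p2 \<in> connected_component_set (- (S \<union> A)) p3"
    by (auto intro: connected_component_sym)
  moreover have "connected_component_set (- (S \<union> A)) p1 = f1" "connected_component_set (- (S \<union> A)) p2 = f2"
      "connected_component_set (- (S \<union> A)) p3 = f3"
    using component_eq_connected_component_set[OF f(1) p1(1)] component_eq_connected_component_set[OF f(2) p2(1)]
      component_eq_connected_component_set[OF f(3) p3(1)] by simp_all
  ultimately show ?thesis
    using connected_component_eq[of p1 "- (S \<union> A)" p2] connected_component_eq[of p1 "- (S \<union> A)" p3]
      connected_component_eq[of p2 "- (S \<union> A)" p3] by argo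
qed

text \<open>By invariance of dimension, a nonempty open plane set does not embed into the
  line.\<close>

lemma interior_arc_image:
  fixes g :: "real \<Rightarrow> complex"
  assumes "arc g" shows "interior (path_image g) = {}"
proof (rule ccontr)
  assume ne: "\<not> ?thesis"
  have "path_image g homeomorphic {0..1::real}"
    by (simp add: assms homeomorphic_arc_image_interval)
  then obtain h k where hk: "homeomorphism (path_image g) {0..1::real} h k"
    unfolding homeomorphic_def by blast
  have sub: "interior (path_image g) \<subseteq> path_image g" by (rule interior_subset)
  have "continuous_on (interior (path_image g)) h"
    using homeomorphism_cont1[OF hk] sub continuous_on_subset by blast
  moreover have "inj_on h (interior (path_image g))"
    using homeomorphism_apply1[OF hk] sub by (metis inj_on_def subsetD)
  ultimately have "DIM(complex) \<le> DIM(real)"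
    using invariance_of_dimension[of "interior (path_image g)" h] ne by simp
  then show False by simp
qed

section \<open>Forests\<close>

text \<open>Acyclicity without cycles: a finite edge set contains a cycle iff it has a nonempty subset
  without vertices of degree 1. Leaf induction is then immediate.\<close>

definition forest :: "'a set set \<Rightarrow> bool" where
  "forest F \<longleftrightarrow> (\<forall>F'\<subseteq>F. F' \<noteq> {} \<longrightarrow> (\<exists>v. vertex_degree F' v = 1))"

lemma forest_subset: "forest F \<Longrightarrow> G \<subseteq> F \<Longrightarrow> forest G"
  unfolding forest_def by (meson subset_trans)

lemma sum_vertex_degree:
  assumes "finite F" "finite W"
  shows "(\<Sum>v\<in>W. vertex_degree F v) = (\<Sum>e\<in>F. card (e \<inter> W))"
proof -
  have "(\<Sum>v\<in>W. vertex_degree F v) = (\<Sum>v\<in>W. \<Sum>e\<in>F. if v \<in> e then 1 else 0)"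
    using assms by (intro sum.cong) (auto simp: vertex_degree_def sum.If_cases Int_def)
  also have "\<dots> = (\<Sum>e\<in>F. \<Sum>v\<in>W. if v \<in> e then 1 else 0)"
    by (rule sum.swap)
  also have "\<dots> = (\<Sum>e\<in>F. card (e \<inter> W))"
    using assms by (intro sum.cong) (auto simp: sum.If_cases Int_def conj_commute)
  finally show ?thesis .
qed

lemma handshake:
  assumes "finite F" "\<And>e. e \<in> F \<Longrightarrow> card e = 2" "finite W" "\<Union>F \<subseteq> W"
  shows "(\<Sum>v\<in>W. vertex_degree F v) = 2 * card F"
proof -
  have "(\<Sum>e\<in>F. card (e \<inter> W)) = (\<Sum>e\<in>F. 2)"
    using assms by (intro sum.cong) (auto simp: Int_absorb2 Sup_le_iff)
  then show ?thesis using assms by (simp add: sum_vertex_degree)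
qed

lemma vertex_degree_pos: "finite F \<Longrightarrow> v \<in> \<Union>F \<Longrightarrow> vertex_degree F v > 0"
  unfolding vertex_degree_def by (subst card_gt_0_iff) auto

lemma finite_Union_edges:
  assumes "finite F" "\<And>e. e \<in> F \<Longrightarrow> card e = 2"
  shows "finite (\<Union>F)"
  using assms by (metis finite_Union card.infinite zero_neq_numeral)

lemma forest_induct [consumes 2, case_names empty leaf]:
  assumes "finite F" "forest F"
    and "P {}"
    and step: "\<And>F e v. \<lbrakk>finite F; forest F; e \<in> F; {f \<in> F. v \<in> f} = {e}; P (F - {e})\<rbrakk> \<Longrightarrow> P F"
  shows "P F"
  using assms(1,2)
proof (induction F rule: finite_psubset_induct)
  case (psubset F)
  show ?case
  proof (cases "F = {}")
    case False
    then obtain v where "vertex_degree F v = 1"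
      using psubset.prems unfolding forest_def by blast
    then obtain e where e: "{f \<in> F. v \<in> f} = {e}"
      unfolding vertex_degree_def by (metis card_1_singletonE)
    then have eF: "e \<in> F" by blast
    have "P (F - {e})"
      by (rule psubset.IH) (use eF psubset.prems forest_subset[of F] in auto)
    with step[OF psubset.hyps psubset.prems eF e] show ?thesis by blast
  qed (simp add: assms(3))
qed

lemma card_forest_less:
  assumes "finite F" "forest F" "\<And>e. e \<in> F \<Longrightarrow> card e = 2" "F \<noteq> {}"
  shows "card F < card (\<Union>F)"
  using assms
proof (induction rule: forest_induct)
  case (leaf F e v)
  have fin: "finite (\<Union>F)" using leaf by (intro finite_Union_edges)
  show ?case
  proof (cases "F - {e} = {}")
    case True
    then have "F = {e}" using leaf by blast
    then show ?thesis using leaf(6) by simp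
  next
    case False
    then have "card (F - {e}) < card (\<Union>(F - {e}))" using leaf by blast
    moreover have "v \<in> \<Union>F" "v \<notin> \<Union>(F - {e})" using leaf(4) by auto
    then have "card (\<Union>(F - {e})) < card (\<Union>F)"
      by (intro psubset_card_mono[OF fin]) auto
    ultimately show ?thesis using leaf(1,3) by (simp add: card_Diff_singleton)
  qed
qed simp

lemma maximal_forest:
  assumes "finite F"
  obtains T where "T \<subseteq> F" "forest T" "\<And>e. e \<in> F - T \<Longrightarrow> \<not> forest (insert e T)"
proof -
  define \<T> where "\<T> = {T. T \<subseteq> F \<and> forest T}"
  have "finite \<T>" using assms by (simp add: \<T>_def)
  moreover have "{} \<in> \<T>" by (simp add: \<T>_def forest_def)
  ultimately have "\<exists>T\<in>\<T>. \<forall>T'\<in>\<T>. T \<subseteq> T' \<longrightarrow> T = T'"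
    by (intro finite_has_maximal) auto
  then obtain T where T: "T \<in> \<T>" and max: "\<forall>T'\<in>\<T>. T \<subseteq> T' \<longrightarrow> T = T'" ..
  show thesis
  proof (rule that[of T])
    fix e assume e: "e \<in> F - T"
    show "\<not> forest (insert e T)"
    proof
      assume "forest (insert e T)"
      then have "insert e T \<in> \<T>" using e T by (simp add: \<T>_def)
      then have "T = insert e T" using max by blast
      then show False using e by blast
    qed
  qed (use T in \<open>simp_all add: \<T>_def\<close>)
qed

text \<open>A nonempty \<open>F'\<close> without vertices of degree 1 must use the new edge. If
  \<open>b\<close> were not reachable from \<open>a\<close> in the rest of \<open>F'\<close>, the
  part of that rest around \<open>a\<close> would have degree at least 1 at \<open>a\<close> and at
  least 2 at its other vertices. By parity it would have at least as many edges as vertices, too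
  many for a forest.\<close>

lemma forest_insert_cycle_imp_reachable:
  assumes "finite T" "forest T" "\<And>e. e \<in> T \<Longrightarrow> card e = 2"
    and "a \<noteq> b" "{a, b} \<notin> T" "\<not> forest (insert {a, b} T)"
  shows "(a, b) \<in> {(x, y). {x, y} \<in> T}\<^sup>*"
proof -
  obtain F' where F': "F' \<subseteq> insert {a, b} T" "F' \<noteq> {}" "\<And>v. vertex_degree F' v \<noteq> 1"
    using assms(6) unfolding forest_def by blast
  have eF': "{a, b} \<in> F'" using F' assms(2) unfolding forest_def by blast
  define G where "G = F' - {{a, b}}"
  have GT: "G \<subseteq> T" using F'(1) by (auto simp: G_def)
  have fin: "finite G" "finite F'" using GT F'(1) assms(1) by (auto intro: finite_subset)
  let ?R = "{(x, y). {x, y} \<in> G}"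
  define C where "C = {c. (a, c) \<in> ?R\<^sup>*}"
  have "b \<in> C"
  proof (rule ccontr)
    assume "b \<notin> C"
    define H where "H = {g \<in> G. g \<subseteq> C}"
    have H: "finite H" "H \<subseteq> T" "\<And>e. e \<in> H \<Longrightarrow> card e = 2" using fin GT assms by (auto simp: H_def)
    have clos: "g \<subseteq> C" if "g \<in> G" "c \<in> g" "c \<in> C" for g c
    proof -
      have "card g = 2" using that GT assms by auto
      then obtain d where d: "g = {c, d}" using \<open>c \<in> g\<close> by (auto simp: card_2_iff)
      then have "(c, d) \<in> ?R" using that by auto
      then have "d \<in> C" using that(3) by (auto simp: C_def intro: rtrancl_into_rtrancl)
      then show ?thesis using d that by auto
    qed
    have degH: "vertex_degree H c = vertex_degree G c" if "c \<in> C" for c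
      unfolding vertex_degree_def H_def using clos that by (intro arg_cong[of _ _ card]) auto
    have "a \<in> C" by (simp add: C_def)
    have "vertex_degree F' a \<noteq> 0" using eF' fin vertex_degree_pos[of F' a] by auto
    then have "vertex_degree F' a \<ge> 2" using F'(3)[of a] by simp
    moreover have "vertex_degree G a = vertex_degree F' a - 1"
    proof -
      have "{e \<in> G. a \<in> e} = {e \<in> F'. a \<in> e} - {{a, b}}" by (auto simp: G_def)
      then show ?thesis using eF' by (simp add: vertex_degree_def)
    qed
    ultimately have dega: "vertex_degree H a \<ge> 1" using degH[OF \<open>a \<in> C\<close>] by simp
    then have "H \<noteq> {}" by (auto simp: vertex_degree_def)
    have "\<Union>H \<subseteq> C" by (auto simp: H_def)
    have aH: "a \<in> \<Union>H"
    proof (rule ccontr)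
      assume "a \<notin> \<Union>H"
      then have "{e \<in> H. a \<in> e} = {}" by auto
      then show False using dega unfolding vertex_degree_def by (metis card.empty not_one_le_zero)
    qed
    have finU: "finite (\<Union>H)" using H by (intro finite_Union_edges)
    have deg2: "vertex_degree H c \<ge> 2" if "c \<in> \<Union>H - {a}" for c
    proof -
      have c: "c \<in> C" "c \<noteq> a" "c \<noteq> b" using that \<open>\<Union>H \<subseteq> C\<close> \<open>b \<notin> C\<close> by auto
      then have "{e \<in> G. c \<in> e} = {e \<in> F'. c \<in> e}" by (auto simp: G_def)
      then have "vertex_degree H c \<noteq> 1" using F'(3)[of c] degH[OF c(1)] by (simp add: vertex_degree_def)
      moreover have "vertex_degree H c > 0" using vertex_degree_pos[OF H(1)] that by blast
      ultimately show ?thesis by simp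
    qed
    have "2 * card H = (\<Sum>v\<in>\<Union>H. vertex_degree H v)"
      using handshake[OF H(1,3) finU] by simp
    also have "\<dots> = vertex_degree H a + (\<Sum>v\<in>\<Union>H - {a}. vertex_degree H v)"
      by (rule sum.remove[OF finU aH])
    finally have "2 * card H = \<dots>" .
    moreover have "(\<Sum>v\<in>\<Union>H - {a}. vertex_degree H v) \<ge> (\<Sum>v\<in>\<Union>H - {a}. 2)"
      using deg2 by (intro sum_mono)
    moreover have "(\<Sum>v\<in>\<Union>H - {a}. (2::nat)) = 2 * (card (\<Union>H) - 1)"
      using finU aH by simp
    ultimately have "2 * card H \<ge> 1 + 2 * (card (\<Union>H) - 1)" using dega by linarith
    moreover have "card H < card (\<Union>H)"
      using card_forest_less[OF H(1) _ H(3) \<open>H \<noteq> {}\<close>] forest_subset[OF assms(2) H(2)] by blast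
    ultimately show False by simp
  qed
  then have "(a, b) \<in> ?R\<^sup>*" by (simp add: C_def)
  moreover have "?R \<subseteq> {(x, y). {x, y} \<in> T}" using GT by auto
  ultimately show ?thesis using rtrancl_mono by blast
qed

text \<open>A nonempty subset without vertices of degree 1 has minimum degree 2. All neighbors of
  the first vertex of a longest path lie on the path, so a second neighbor closes a cycle. Its
  length is at most the number of vertices, which by the handshake sum is at most the number of
  edges.\<close>

lemma card_ge_of_not_forest:
  assumes F: "finite F" "\<And>e. e \<in> F \<Longrightarrow> card e = 2" "\<Union>F \<subseteq> V"
    and "\<not> forest F" and cyc: "\<And>c. is_cycle V F c \<Longrightarrow> length c \<ge> n"
  shows "n \<le> card F"
proof -
  obtain F' where F': "F' \<subseteq> F" "F' \<noteq> {}" "\<And>v. vertex_degree F' v \<noteq> 1"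
    using assms(4) unfolding forest_def by blast
  have fin: "finite F'" "\<And>e. e \<in> F' \<Longrightarrow> card e = 2" using F' F by (auto intro: finite_subset)
  have finU: "finite (\<Union>F')" using fin by (intro finite_Union_edges)
  have deg: "vertex_degree F' v \<ge> 2" if "v \<in> \<Union>F'" for v
    using vertex_degree_pos[OF fin(1) that] F'(3)[of v] by simp
  define P where "P = {p. p \<noteq> [] \<and> distinct p \<and> set p \<subseteq> \<Union>F' \<and> successively (\<lambda>x y. {x, y} \<in> F') p}"
  have "length p < Suc (card (\<Union>F'))" if "p \<in> P" for p
    using that finU card_mono[of "\<Union>F'" "set p"] by (auto simp: P_def distinct_card)
  moreover obtain v where "v \<in> \<Union>F'"
  proof -
    obtain e where "e \<in> F'" using F'(2) by blast
    moreover have "e \<noteq> {}" using fin(2)[OF calculation] by auto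
    ultimately show thesis using that by blast
  qed
  then have "[v] \<in> P" by (simp add: P_def)
  ultimately obtain p where p: "p \<in> P" and max: "\<And>q. q \<in> P \<Longrightarrow> length q \<le> length p"
    using ex_has_greatest_nat[of "\<lambda>p. p \<in> P" "[v]" length "Suc (card (\<Union>F'))"] by blast
  obtain x q where pq: "p = x # q" using p by (cases p) (auto simp: P_def)
  have xU: "x \<in> \<Union>F'" using p pq by (auto simp: P_def)
  have nb: "u \<in> set p" if "{x, u} \<in> F'" for u
  proof (rule ccontr)
    assume "u \<notin> set p"
    then have "u # p \<in> P" using p that pq by (auto simp: P_def insert_commute)
    then show False using max by fastforce
  qed
  have "2 \<le> card {e \<in> F'. x \<in> e}" using deg[OF xU] by (simp add: vertex_degree_def)
  \<comment> \<open>If \<open>p\<close> has length 1, then \<open>p ! 1\<close> is unspecified; this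
    does no harm, as at most one edge is excluded either way.\<close>
  then have "\<not> {e \<in> F'. x \<in> e} \<subseteq> {{x, p ! 1}}"
    using card_mono[of "{{x, p ! 1}}" "{e \<in> F'. x \<in> e}"] by auto
  then obtain e where e: "e \<in> F'" "x \<in> e" "e \<noteq> {x, p ! 1}" by blast
  obtain u where u: "e = {x, u}" "u \<noteq> x" using fin(2)[OF e(1)] e(2) by (auto simp: card_2_iff)
  have "u \<in> set p" using nb e(1) u by blast
  then obtain i where i: "i < length p" "p ! i = u" by (auto simp: in_set_conv_nth)
  have i2: "i \<ge> 2"
  proof -
    have "i \<noteq> 0" using i u(2) pq by (auto simp: nth_Cons split: nat.splits)
    moreover have "i \<noteq> 1" using i e(3) u by auto
    ultimately show ?thesis by simp
  qed
  let ?c = "take (Suc i) p"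
  have "is_cycle V F ?c"
    unfolding is_cycle_def
  proof (intro conjI)
    show "length ?c \<ge> 3" using i i2 by simp
    show "distinct ?c" using p by (auto simp: P_def)
    have "\<Union>F' \<subseteq> V" using F'(1) F(3) by blast
    then show "set ?c \<subseteq> V" using p set_take_subset[of "Suc i" p] unfolding P_def by blast
    have "successively (\<lambda>x y. {x, y} \<in> F') (take (Suc i) p @ drop (Suc i) p)"
      using p by (simp add: P_def)
    then have "successively (\<lambda>x y. {x, y} \<in> F') ?c"
      unfolding successively_append_iff by blast
    then show "successively (\<lambda>x y. {x, y} \<in> F) ?c"
      by (rule successively_mono) (use F' in auto)
    have "last ?c = u" using i by (simp add: take_Suc_conv_app_nth)
    moreover have "hd ?c = x" using pq by simp
    ultimately show "{last ?c, hd ?c} \<in> F" using e(1) u F' by (auto simp: insert_commute)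
  qed
  then have "n \<le> length ?c" by (rule cyc)
  also have "\<dots> = card (set ?c)" using p by (simp add: P_def distinct_card)
  also have "\<dots> \<le> card (\<Union>F')"
    using p set_take_subset[of "Suc i" p] by (intro card_mono finU) (auto simp: P_def)
  also have "2 * \<dots> \<le> 2 * card F'"
    using sum_mono[of "\<Union>F'" "\<lambda>_. 2" "vertex_degree F'"] deg handshake[OF fin finU] by simp
  then have "card (\<Union>F') \<le> card F'" by simp
  also have "\<dots> \<le> card F" using F F' by (intro card_mono)
  finally show ?thesis .
qed

section \<open>Faces of a drawing\<close>

locale drawn_graph =
  fixes V :: "'a set" and E :: "'a set set" and pos :: "'a \<Rightarrow> complex" and arcs :: "'a set \<Rightarrow> real \<Rightarrow> complex"
  assumes graph: "simple_graph V E" and drawing: "plane_drawing V E pos arcs"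
begin

definition drawn :: "'a set set \<Rightarrow> complex set" where
  "drawn F = (\<Union>e\<in>F. path_image (arcs e))"

lemma finite_E: "finite E"
  using graph unfolding simple_graph_def by (metis PowI finite_Pow_iff finite_subset subsetI)

lemma card_edge: "e \<in> E \<Longrightarrow> card e = 2"
  using graph by (simp add: simple_graph_def)

lemma arc_arcs: "e \<in> E \<Longrightarrow> arc (arcs e)"
  and ends_arcs: "e \<in> E \<Longrightarrow> {pathstart (arcs e), pathfinish (arcs e)} = pos ` e"
  and arcs_Int: "e \<in> E \<Longrightarrow> f \<in> E \<Longrightarrow> e \<noteq> f \<Longrightarrow> path_image (arcs e) \<inter> path_image (arcs f) = pos ` (e \<inter> f)"
  using drawing unfolding plane_drawing_def by blast+

lemma inj_pos: "inj_on pos V"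
  using drawing unfolding plane_drawing_def by blast

lemma pos_edge_subset: "e \<in> E \<Longrightarrow> pos ` e \<subseteq> path_image (arcs e)"
  using ends_arcs[of e] by (metis empty_subsetI insert_subset pathfinish_in_path_image pathstart_in_path_image)

lemma arcs_image:
  assumes "e \<in> E"
  shows compact_arcs: "compact (path_image (arcs e))"
    and connected_arcs: "connected (path_image (arcs e))"
    and contractible_arcs: "contractible (path_image (arcs e))"
    and interior_arcs: "interior (path_image (arcs e)) = {}"
    and connected_Compl_arcs: "connected (- path_image (arcs e))"
    and connected_open_arcs: "connected (path_image (arcs e) - pos ` e)"
proof -
  note a = arc_arcs[OF assms]
  show "compact (path_image (arcs e))" using a by (rule compact_arc_image)
  show "connected (path_image (arcs e))" using a by (rule connected_arc_image)
  have "path_image (arcs e) homeomorphic {0..1::real}"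
    using a by (simp add: homeomorphic_arc_image_interval)
  moreover have "contractible {0..1::real}" by (simp add: convex_imp_contractible)
  ultimately show "contractible (path_image (arcs e))" using homeomorphic_contractible_eq by blast
  show "interior (path_image (arcs e)) = {}" using a by (rule interior_arc_image)
  show "connected (- path_image (arcs e))" using a by (intro connected_arc_complement) simp_all
  show "connected (path_image (arcs e) - pos ` e)"
    using connected_simple_path_endless[OF arc_imp_simple_path[OF a]] ends_arcs[OF assms] by simp
qed

lemma compact_drawn: "F \<subseteq> E \<Longrightarrow> compact (drawn F)"
  unfolding drawn_def using finite_E compact_arcs by (meson compact_UN finite_subset subsetD)

lemma drawn_insert: "drawn (insert e F) = drawn F \<union> path_image (arcs e)"
  by (auto simp: drawn_def)

lemma drawn_Int_arcs:
  assumes "F \<subseteq> E" "e \<in> E" "e \<notin> F"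
  shows "drawn F \<inter> path_image (arcs e) = pos ` (e \<inter> \<Union>F)"
proof -
  have "drawn F \<inter> path_image (arcs e) = (\<Union>f\<in>F. path_image (arcs f) \<inter> path_image (arcs e))"
    by (auto simp: drawn_def)
  also have "\<dots> = (\<Union>f\<in>F. pos ` (f \<inter> e))"
  proof (rule SUP_cong[OF refl])
    fix f assume f: "f \<in> F"
    show "path_image (arcs f) \<inter> path_image (arcs e) = pos ` (f \<inter> e)"
      by (rule arcs_Int) (use f assms in auto)
  qed
  also have "\<dots> = pos ` (e \<inter> \<Union>F)" by auto
  finally show ?thesis .
qed

lemma pos_in_drawn:
  assumes "F \<subseteq> E" "v \<in> \<Union>F"
  shows "pos v \<in> drawn F"
proof -
  obtain e where e: "e \<in> F" "v \<in> e" using assms(2) ..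
  then have "pos v \<in> path_image (arcs e)" using pos_edge_subset[of e] assms(1) by auto
  then show ?thesis using e(1) by (auto simp: drawn_def)
qed

text \<open>A leaf edge meets the rest of the drawing in at most one point, so by Janiszewski's
  theorem attaching it does not separate the plane.\<close>

lemma connected_Compl_drawn_forest:
  assumes "F \<subseteq> E" "forest F"
  shows "connected (- drawn F)"
proof -
  have "finite F" using assms(1) finite_E by (rule finite_subset)
  then have "F \<subseteq> E \<longrightarrow> connected (- drawn F)"
    using assms(2)
  proof (induction rule: forest_induct)
    case empty
    show ?case by (simp add: drawn_def connected_UNIV)
  next
    case (leaf F e v)
    show ?case
    proof
      assume FE: "F \<subseteq> E"
      then have e: "e \<in> E" "F - {e} \<subseteq> E" using leaf by auto
      have "v \<in> e" "v \<notin> \<Union>(F - {e})" using leaf(4) by auto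
      moreover obtain w where "e = {v, w}"
        using card_edge[OF e(1)] \<open>v \<in> e\<close> by (auto simp: card_2_iff)
      ultimately have "e \<inter> \<Union>(F - {e}) \<subseteq> {w}" by blast
      then have "e \<inter> \<Union>(F - {e}) = {} \<or> e \<inter> \<Union>(F - {e}) = {w}" by blast
      moreover have "drawn (F - {e}) \<inter> path_image (arcs e) = pos ` (e \<inter> \<Union>(F - {e}))"
        by (rule drawn_Int_arcs[OF e(2,1)]) simp
      ultimately have conn: "connected (drawn (F - {e}) \<inter> path_image (arcs e))"
        by (metis connected_empty connected_sing image_empty image_insert)
      have "drawn F = drawn (F - {e}) \<union> path_image (arcs e)"
        using drawn_insert[of e "F - {e}"] leaf(3) by (simp add: insert_absorb)
      moreover have "connected (- drawn (F - {e}))" using leaf(5) e(2) by blast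
      ultimately show "connected (- drawn F)"
        using connected_complement_Un[OF compact_drawn[OF e(2)] compact_imp_closed[OF compact_arcs[OF e(1)]]
            _ connected_Compl_arcs[OF e(1)] conn] by (simp only:)
    qed
  qed
  then show ?thesis using assms by blast
qed

text \<open>The ends of the arc are excluded because a face can touch a vertex without running along
  every edge at that vertex.\<close>

definition borders :: "'a set set \<Rightarrow> complex set \<Rightarrow> 'a set set" where
  "borders F f = {e \<in> F. frontier f \<inter> (path_image (arcs e) - pos ` e) \<noteq> {}}"

text \<open>Remove the bordering edges and all ends of edges from the plane. If the bordering edges
  form a forest, the remainder \<open>M\<close> is connected and contains both faces, hence a
  frontier point of \<open>f\<close>. That point lies inside some edge, which therefore borders
  \<open>f\<close> and was removed.\<close>

lemma borders_not_forest:
  assumes F: "F \<subseteq> E" and f: "f \<in> components (- drawn F)" and g: "g \<in> components (- drawn F)" "g \<noteq> f"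
  shows "\<not> forest (borders F f)"
proof
  assume forest: "forest (borders F f)"
  have BF: "borders F f \<subseteq> F" by (auto simp: borders_def)
  define M where "M = - drawn (borders F f) - pos ` \<Union>F"
  have "finite (\<Union>F)"
    using F finite_E card_edge by (intro finite_Union_edges) (auto intro: finite_subset)
  moreover have "open (- drawn (borders F f))"
    using compact_drawn[of "borders F f"] BF F by (meson compact_imp_closed open_Compl order_trans)
  moreover have "connected (- drawn (borders F f))"
    using BF F forest by (intro connected_Compl_drawn_forest) auto
  ultimately have "connected M" unfolding M_def by (intro connected_open_delete_finite) auto
  have "- drawn F \<subseteq> M"
  proof
    fix z assume z: "z \<in> - drawn F"
    have "drawn (borders F f) \<subseteq> drawn F" using BF unfolding drawn_def by (rule UN_mono) simp
    then have "z \<notin> drawn (borders F f)" using z by blast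
    moreover have "z \<notin> pos ` \<Union>F" using z pos_in_drawn[OF F] by auto
    ultimately show "z \<in> M" by (simp add: M_def)
  qed
  moreover have "f \<subseteq> - drawn F" "g \<subseteq> - drawn F" using f g in_components_subset by blast+
  moreover have "f \<noteq> {}" "g \<noteq> {}" using f g in_components_nonempty by blast+
  moreover have "f \<inter> g = {}" using components_nonoverlap[OF f g(1)] g(2) by blast
  ultimately have "M \<inter> f \<noteq> {}" "M - f \<noteq> {}" by blast+
  then have "M \<inter> frontier f \<noteq> {}" by (rule connected_Int_frontier[OF \<open>connected M\<close>])
  then obtain y where y: "y \<in> M" "y \<in> frontier f" by blast
  have "y \<in> drawn F"
    using frontier_of_components_closed_complement[OF compact_imp_closed[OF compact_drawn[OF F]] f] y by blast
  then obtain e where e: "e \<in> F" "y \<in> path_image (arcs e)" by (auto simp: drawn_def)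
  have "y \<notin> pos ` e" using y(1) e(1) by (auto simp: M_def)
  then have "e \<in> borders F f" using e y by (auto simp: borders_def)
  then show False using y(1) e(2) by (auto simp: M_def drawn_def)
qed

lemma card_bordered_le_2:
  assumes F: "F \<subseteq> E" "e \<in> F" and C: "finite C" "C \<subseteq> components (- drawn F)"
  shows "card {f \<in> C. e \<in> borders F f} \<le> 2"
proof (rule ccontr)
  assume "\<not> ?thesis"
  then have "3 \<le> card {f \<in> C. e \<in> borders F f}" by simp
  then obtain X where X: "X \<subseteq> {f \<in> C. e \<in> borders F f}" "card X = 3"
    by (meson obtain_subset_with_card_n)
  obtain f1 f2 f3 where f123: "X = {f1, f2, f3}" "f1 \<noteq> f2" "f2 \<noteq> f3" "f1 \<noteq> f3"
    using X(2) by (auto simp: card_3_iff)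
  then have f: "f1 \<in> C" "f2 \<in> C" "f3 \<in> C" "e \<in> borders F f1" "e \<in> borders F f2" "e \<in> borders F f3"
    using X(1) by simp_all
  have e: "e \<in> E" "F - {e} \<subseteq> E" using F by auto
  obtain a b where ab: "e = {a, b}" using card_edge[OF e(1)] by (auto simp: card_2_iff)
  then have pab: "pos ` e = {pos a, pos b}" by simp
  have S: "drawn F = drawn (F - {e}) \<union> path_image (arcs e)"
    using drawn_insert[of e "F - {e}"] F(2) by (simp add: insert_absorb)
  have "f1 = f2 \<or> f1 = f3 \<or> f2 = f3"
  proof (rule arc_borders_two_components)
    show "compact (drawn (F - {e}))" by (rule compact_drawn[OF e(2)])
    show "compact (path_image (arcs e))" "contractible (path_image (arcs e))"
      by (rule arcs_image[OF e(1)])+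
    show "drawn (F - {e}) \<inter> path_image (arcs e) \<subseteq> {pos a, pos b}"
      using drawn_Int_arcs[OF e(2,1)] pab by auto
    show "connected (path_image (arcs e) - {pos a, pos b})"
      using connected_open_arcs[OF e(1)] pab by simp
    show "f1 \<in> components (- (drawn (F - {e}) \<union> path_image (arcs e)))"
      "f2 \<in> components (- (drawn (F - {e}) \<union> path_image (arcs e)))"
      "f3 \<in> components (- (drawn (F - {e}) \<union> path_image (arcs e)))"
      using f(1-3) C(2) unfolding S by (simp_all only: subset_iff)
    show "frontier f1 \<inter> (path_image (arcs e) - {pos a, pos b}) \<noteq> {}"
      "frontier f2 \<inter> (path_image (arcs e) - {pos a, pos b}) \<noteq> {}"
      "frontier f3 \<inter> (path_image (arcs e) - {pos a, pos b}) \<noteq> {}"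
      using f(4-6) unfolding borders_def pab[symmetric] by simp_all
  qed
  then show False using f123 by simp
qed

text \<open>Double counting of pairs of a face and a bordering edge; a second face is there to make
  \<open>borders_not_forest\<close> applicable. \<open>C\<close> is a finite selection of faces
  because the finiteness of their number is itself derived from this bound.\<close>

lemma card_faces_le:
  assumes F: "F \<subseteq> E" and cyc: "\<And>c. is_cycle V F c \<Longrightarrow> n \<le> length c"
    and C: "finite C" "C \<subseteq> components (- drawn F)" "card C \<ge> 2"
  shows "n * card C \<le> 2 * card F"
proof -
  have finF: "finite F" using F finite_E by (rule finite_subset)
  have "n \<le> card (borders F f)" if f: "f \<in> C" for f
  proof -
    have "\<not> C \<subseteq> {f}" using C(3) card_mono[of "{f}" C] by auto
    then obtain g where "g \<in> C" "g \<noteq> f" by blast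
    then have nf: "\<not> forest (borders F f)" using borders_not_forest[OF F] f C(2) by blast
    have BF: "borders F f \<subseteq> F" by (auto simp: borders_def)
    show ?thesis
    proof (rule card_ge_of_not_forest[OF _ _ _ nf])
      show "finite (borders F f)" using BF finF by (rule finite_subset)
      show "card e = 2" if "e \<in> borders F f" for e using that BF F card_edge by blast
      show "\<Union> (borders F f) \<subseteq> V" using BF F graph unfolding simple_graph_def by blast
      fix c assume "is_cycle V (borders F f) c"
      then have "is_cycle V F c"
        unfolding is_cycle_def using BF by (auto elim!: successively_mono)
      then show "n \<le> length c" by (rule cyc)
    qed
  qed
  then have "n * card C \<le> (\<Sum>f\<in>C. card (borders F f))"
    using sum_mono[of C "\<lambda>_. n" "\<lambda>f. card (borders F f)"] by (simp add: mult.commute)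
  also have "\<dots> = (\<Sum>f\<in>C. \<Sum>e\<in>F. if e \<in> borders F f then 1 else 0)"
    using finF by (intro sum.cong) (auto simp: sum.If_cases borders_def Int_def)
  also have "\<dots> = (\<Sum>e\<in>F. \<Sum>f\<in>C. if e \<in> borders F f then 1 else 0)"
    by (rule sum.swap)
  also have "\<dots> = (\<Sum>e\<in>F. card {f \<in> C. e \<in> borders F f})"
    using C(1) by (intro sum.cong) (auto simp: sum.If_cases Int_def)
  also have "\<dots> \<le> (\<Sum>e\<in>F. 2)"
    using card_bordered_le_2[OF F _ C(1,2)] by (intro sum_mono)
  finally show ?thesis by simp
qed

text \<open>With n = 2 the face bound allows at most \<open>card F\<close> faces in any finite
  selection of two or more.\<close>

lemma finite_faces:
  assumes F: "F \<subseteq> E" and cyc: "\<And>c. is_cycle V F c \<Longrightarrow> 2 \<le> length c"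
  shows "finite (components (- drawn F))"
proof (rule ccontr)
  assume "\<not> ?thesis"
  then obtain C where C: "finite C" "card C = card F + 2" "C \<subseteq> components (- drawn F)"
    using infinite_arbitrarily_large by blast
  have "2 * card C \<le> 2 * card F" by (rule card_faces_le[OF F cyc C(1,3)]) (use C in auto)
  then show False using C(2) by simp
qed

section \<open>Euler's inequality\<close>

lemma connected_component_drawn:
  assumes "T \<subseteq> E" "(a, c) \<in> {(x, y). {x, y} \<in> T}\<^sup>*" "a \<in> \<Union>T"
  shows "connected_component (drawn T) (pos a) (pos c)"
  using assms(2)
proof (induction rule: rtrancl_induct)
  case base
  show ?case using pos_in_drawn[OF assms(1,3)] by (rule connected_component_refl)
next
  case (step c d)
  then have cd: "{c, d} \<in> T" "{c, d} \<in> E" using assms(1) by auto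
  have "connected_component (drawn T) (pos c) (pos d)"
    unfolding connected_component_def
  proof (intro exI conjI)
    show "connected (path_image (arcs {c, d}))" by (rule connected_arcs[OF cd(2)])
    show "path_image (arcs {c, d}) \<subseteq> drawn T" using cd(1) by (auto simp: drawn_def)
    show "pos c \<in> path_image (arcs {c, d})" "pos d \<in> path_image (arcs {c, d})"
      using pos_edge_subset[OF cd(2)] by auto
  qed
  with step.IH show ?case by (rule connected_component_trans)
qed

text \<open>\<open>S\<close> is the component of \<open>T\<close> around \<open>a\<close>. The whole
  forest may be disconnected, while \<open>card_components_add_arc\<close> asks for a connected set
  that contains both ends of the new arc and does not separate the plane.\<close>

lemma forest_connecting_subset:
  assumes T: "T \<subseteq> E" "forest T" and ab: "(a, b) \<in> {(x, y). {x, y} \<in> T}\<^sup>*" "a \<noteq> b"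
  obtains S where "S \<subseteq> T" "connected (drawn S)" "connected (- drawn S)" "a \<in> \<Union>S" "b \<in> \<Union>S"
proof -
  define C where "C = {c. (a, c) \<in> {(x, y). {x, y} \<in> T}\<^sup>*}"
  define S where "S = {e \<in> T. e \<subseteq> C}"
  have ST: "S \<subseteq> T" "S \<subseteq> E" using T by (auto simp: S_def)
  have reach: "(a, c) \<in> {(x, y). {x, y} \<in> S}\<^sup>*" if "(a, c) \<in> {(x, y). {x, y} \<in> T}\<^sup>*" for c
    using that
  proof (induction rule: rtrancl_induct)
    case (step c d)
    then have "c \<in> C" "d \<in> C" by (auto simp: C_def intro: rtrancl_into_rtrancl)
    then have "{c, d} \<in> S" using step(2) by (auto simp: S_def)
    then show ?case using step.IH by (auto intro: rtrancl_into_rtrancl)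
  qed simp
  have inS: "a \<in> \<Union>S"
    using reach[OF ab(1)] ab(2) by (cases rule: converse_rtranclE) auto
  have inS': "b \<in> \<Union>S"
    using reach[OF ab(1)] ab(2) by (cases rule: rtranclE) auto
  have "connected_component (drawn S) (pos a) z" if z: "z \<in> drawn S" for z
  proof -
    obtain e where e: "e \<in> S" "z \<in> path_image (arcs e)" using z unfolding drawn_def by blast
    have eE: "e \<in> E" using e ST by blast
    obtain c where c: "c \<in> e" using card_edge[OF eE] by (auto simp: card_2_iff)
    then have "(a, c) \<in> {(x, y). {x, y} \<in> T}\<^sup>*" using e(1) by (auto simp: S_def C_def)
    from connected_component_drawn[OF ST(2) reach[OF this] inS]
    have "connected_component (drawn S) (pos a) (pos c)" .
    moreover have "connected_component (drawn S) (pos c) z"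
      unfolding connected_component_def
      using connected_arcs[OF eE] pos_edge_subset[OF eE] c e by (auto simp: drawn_def intro!: exI[of _ "path_image (arcs e)"])
    ultimately show ?thesis by (rule connected_component_trans)
  qed
  then have "connected (drawn S)"
    unfolding connected_iff_connected_component
    by (meson connected_component_sym connected_component_trans)
  moreover have "connected (- drawn S)"
    using connected_Compl_drawn_forest[OF ST(2)] forest_subset[OF T(2) ST(1)] .
  ultimately show thesis using that ST(1) inS inS' by blast
qed

text \<open>The edges outside \<open>T\<close> are drawn one by one, starting from the single face
  of a forest. By maximality the ends of each are already joined in \<open>T\<close>, so each adds a
  face.\<close>

lemma card_faces_ge:
  assumes F: "F \<subseteq> E" and T: "T \<subseteq> F" "forest T" and max: "\<And>e. e \<in> F - T \<Longrightarrow> \<not> forest (insert e T)"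
    and cyc: "\<And>c. is_cycle V F c \<Longrightarrow> 2 \<le> length c"
  shows "card (F - T) < card (components (- drawn F))"
proof -
  have finF: "finite F" using F finite_E by (rule finite_subset)
  have "card X < card (components (- drawn (T \<union> X)))" if "finite X" "X \<subseteq> F - T" for X
    using that
  proof (induction X rule: finite_induct)
    case empty
    have TE: "T \<subseteq> E" using T F by blast
    have "connected (- drawn T)" by (rule connected_Compl_drawn_forest[OF TE T(2)])
    moreover have "- drawn T \<noteq> {}"
    proof
      assume "- drawn T = {}"
      then have "drawn T = UNIV" by blast
      then show False using compact_imp_bounded[OF compact_drawn[OF TE]] not_bounded_UNIV by metis
    qed
    ultimately have "components (- drawn T) = {- drawn T}" by (simp add: components_eq_sing_iff)
    then show ?case by simp
  next
    case (insert e X)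
    have TX: "T \<union> X \<subseteq> E" "T \<union> X \<subseteq> F" and e: "e \<in> E" "e \<in> F - T" "e \<notin> T \<union> X"
      using insert F T by auto
    obtain a b where ab: "e = {a, b}" "a \<noteq> b" using card_edge[OF e(1)] by (auto simp: card_2_iff)
    have TE: "T \<subseteq> E" "finite T" using TX finF T by (auto intro: finite_subset)
    have "(a, b) \<in> {(x, y). {x, y} \<in> T}\<^sup>*"
      using forest_insert_cycle_imp_reachable[OF TE(2) T(2) _ ab(2)] card_edge TE(1) max[OF e(2)] e(2) ab(1)
      by blast
    then obtain S where S: "S \<subseteq> T" "connected (drawn S)" "connected (- drawn S)" "a \<in> \<Union>S" "b \<in> \<Union>S"
      using forest_connecting_subset[OF TE(1) T(2) _ ab(2)] by blast
    have SE: "S \<subseteq> E" using S TE by blast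
    let ?A = "path_image (arcs e)"
    have pab: "pos ` e = {pos a, pos b}" using ab by simp
    have "e \<inter> \<Union>(T \<union> X) = e" using S ab by blast
    then have int: "drawn (T \<union> X) \<inter> ?A = {pos a, pos b}"
      using drawn_Int_arcs[OF TX(1) e(1,3)] pab by simp
    have ins: "drawn (T \<union> insert e X) = drawn (T \<union> X) \<union> ?A"
      using drawn_insert[of e "T \<union> X"] by simp
    have neq: "pos a \<noteq> pos b"
    proof -
      have "a \<in> V" "b \<in> V" using graph e(1) ab(1) unfolding simple_graph_def by auto
      then show ?thesis using inj_pos ab(2) by (meson inj_onD)
    qed
    have "card (components (- drawn (T \<union> X))) < card (components (- (drawn (T \<union> X) \<union> ?A)))"
    proof (rule card_components_add_arc)
      show "compact (drawn (T \<union> X))" by (rule compact_drawn[OF TX(1)])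
      show "drawn S \<subseteq> drawn (T \<union> X)" using S(1) by (auto simp: drawn_def)
      show "compact (drawn S)" by (rule compact_drawn[OF SE])
      show "connected (drawn S)" "connected (- drawn S)" by fact+
      show "compact ?A" "connected ?A" "interior ?A = {}" by (rule arcs_image[OF e(1)])+
      show "drawn (T \<union> X) \<inter> ?A = {pos a, pos b}" by fact
      show "pos a \<in> drawn S" "pos b \<in> drawn S" using pos_in_drawn[OF SE] S by auto
      show "pos a \<noteq> pos b" by fact
      show "connected (?A - {pos a, pos b})" using connected_open_arcs[OF e(1)] pab by simp
      have "finite (components (- drawn (T \<union> insert e X)))"
      proof (rule finite_faces)
        show "T \<union> insert e X \<subseteq> E" using TX e by blast
        fix c assume "is_cycle V (T \<union> insert e X) c"
        then show "2 \<le> length c" by (simp add: is_cycle_def)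
      qed
      then show "finite (components (- (drawn (T \<union> X) \<union> ?A)))" by (simp only: ins)
    qed
    moreover have "card X < card (components (- drawn (T \<union> X)))" using insert by blast
    ultimately show ?case using insert(1,2) ins by simp
  qed
  from this[of "F - T"] show ?thesis using finF T by (simp add: Un_absorb1)
qed

lemma card_edges_less:
  assumes F: "F \<subseteq> E" "F \<noteq> {}" and cyc: "\<And>c. is_cycle V F c \<Longrightarrow> 6 \<le> length c"
  shows "2 * card F < 3 * card (\<Union>F)"
proof -
  have finF: "finite F" using F(1) finite_E by (rule finite_subset)
  have finU: "finite (\<Union>F)" using finF card_edge F(1) by (intro finite_Union_edges) auto
  obtain T where T: "T \<subseteq> F" "forest T" and max: "\<And>e. e \<in> F - T \<Longrightarrow> \<not> forest (insert e T)"
    using maximal_forest[OF finF] by metis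
  have finT: "finite T" using T finF finite_subset by blast
  have "T \<noteq> {}"
  proof
    assume "T = {}"
    obtain e where e: "e \<in> F" using F by blast
    have "e \<noteq> {}" using card_edge e F(1) by fastforce
    then obtain v where "v \<in> e" by blast
    then have "{f \<in> {e}. v \<in> f} = {e}" by auto
    then have "vertex_degree {e} v = 1" unfolding vertex_degree_def by (metis is_singletonI is_singleton_altdef)
    then have "forest {e}" unfolding forest_def by (metis subset_singletonD)
    then show False using max[of e] e \<open>T = {}\<close> by simp
  qed
  then have "card T < card (\<Union>T)"
    using card_forest_less[OF finT T(2)] T(1) F(1) card_edge by blast
  also have "\<dots> \<le> card (\<Union>F)" using T(1) finU by (intro card_mono) auto
  finally have cT: "card T < card (\<Union>F)" .
  have cFT: "card F = card T + card (F - T)"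
    using card_Un_disjoint[of T "F - T"] finT finF T(1) by (simp add: Un_absorb1)
  show ?thesis
  \<comment> \<open>A forest leaves a single face, to which the face bound does not apply.\<close>
  proof (cases "F = T")
    case True
    then show ?thesis using cT by simp
  next
    case False
    let ?C = "components (- drawn F)"
    have le2: "2 \<le> length c" if "is_cycle V F c" for c using cyc[OF that] by simp
    have 1: "card (F - T) < card ?C" by (rule card_faces_ge[OF F(1) T max le2])
    have "F - T \<noteq> {}" using False T by blast
    then have "card (F - T) > 0" using finF by (simp add: card_gt_0_iff)
    with 1 have "card ?C \<ge> 2" by simp
    \<comment> \<open>With f, t, n for the numbers of edges of \<open>F\<close>, edges of
      \<open>T\<close> and vertices, 6 * (f - t + 1) \<le> 2 * f and t \<le> n - 1 give 2 * f \<le>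
      3 * n - 6.\<close>
    then have "6 * card ?C \<le> 2 * card F"
      using card_faces_le[OF F(1) cyc finite_faces[OF F(1) le2]] by simp
    then show ?thesis using 1 cT cFT by linarith
  qed
qed

end

lemma planar_girth_6_sparse:
  assumes "simple_graph V E" "planar V E" "girth V E \<ge> 6" and W: "W \<subseteq> V" "W \<noteq> {}"
  shows "2 * card {e \<in> E. e \<subseteq> W} < 3 * card W"
proof -
  obtain pos arcs where "plane_drawing V E pos arcs" using assms(2) unfolding planar_def by blast
  with assms(1) interpret drawn_graph V E pos arcs by unfold_locales
  let ?F = "{e \<in> E. e \<subseteq> W}"
  have finW: "finite W" using W(1) assms(1) finite_subset unfolding simple_graph_def by blast
  show ?thesis
  proof (cases "?F = {}")
    case True
    have "card W > 0" using W finW by (simp add: card_gt_0_iff)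
    then show ?thesis unfolding True by simp
  next
    case False
    have "2 * card ?F < 3 * card (\<Union>?F)"
    proof (rule card_edges_less)
      fix c assume "is_cycle V ?F c"
      then have "is_cycle V E c"
        unfolding is_cycle_def by (auto elim!: successively_mono)
      then have "girth V E \<le> enat (length c)"
        unfolding girth_def by (intro Inf_lower) auto
      with assms(3) have "6 \<le> enat (length c)" by (rule order_trans)
      then show "6 \<le> length c" by (simp add: numeral_eq_enat)
    qed (use False in auto)
    \<comment> \<open>\<open>W\<close> may contain vertices that lie on no edge inside it.\<close>
    also have "\<dots> \<le> 3 * card W" using finW by (intro mult_le_mono2 card_mono) auto
    finally show ?thesis .
  qed
qed

section \<open>Conflicts and greedy coloring\<close>

text \<open>The case of two edges sharing an endpoint is covered by taking \<open>g\<close> to be \<open>e\<close>.\<close>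

definition conflict :: "'a set set \<Rightarrow> 'a set \<Rightarrow> 'a set \<Rightarrow> bool" where
  "conflict E e f \<longleftrightarrow> e \<noteq> f \<and> (\<exists>g\<in>E. g \<inter> e \<noteq> {} \<and> g \<inter> f \<noteq> {})"

definition nbs :: "'a set set \<Rightarrow> 'a \<Rightarrow> 'a set" where
  "nbs E v = {w. {v, w} \<in> E}"

definition proper_coloring :: "('e \<Rightarrow> 'e \<Rightarrow> bool) \<Rightarrow> nat \<Rightarrow> 'e set \<Rightarrow> ('e \<Rightarrow> nat) \<Rightarrow> bool" where
  "proper_coloring R k X col \<longleftrightarrow> col ` X \<subseteq> {..<k} \<and> (\<forall>e\<in>X. \<forall>f\<in>X. R e f \<longrightarrow> col e \<noteq> col f)"

text \<open>The bound for an element of \<open>B\<close> counts all its neighbors in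
  \<open>A \<union> B\<close>, so \<open>B\<close> may be colored in any order.\<close>

lemma greedy_coloring:
  assumes "finite A" "finite B" and R: "symp R" "irreflp R"
    and "\<And>e. e \<in> B \<Longrightarrow> card {f \<in> A \<union> B. R e f} < k"
    and "proper_coloring R k A col"
  shows "\<exists>col'. proper_coloring R k (A \<union> B) col'"
  using assms(2,5)
proof (induction B rule: finite_induct)
  case empty
  then show ?case using assms(6) by auto
next
  case (insert b B)
  have fin: "finite {f \<in> A \<union> insert b B. R e f}" for e using assms(1) insert(1) by auto
  have "card {f \<in> A \<union> B. R e f} < k" if "e \<in> B" for e
    using card_mono[OF fin[of e], of "{f \<in> A \<union> B. R e f}"] insert.prems[of e] that by fastforce
  with insert.IH obtain col' where col': "proper_coloring R k (A \<union> B) col'" by blast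
  show ?case
  proof (cases "b \<in> A")
    case True
    then show ?thesis using col' by (metis Un_insert_right insert_absorb Un_iff)
  next
    case False
    let ?X = "{f \<in> A \<union> B. R b f}"
    have "card ?X < k"
      using card_mono[OF fin[of b], of ?X] insert.prems[of b] by fastforce
    moreover have "finite ?X" using assms(1) insert(1) by auto
    ultimately have "card (col' ` ?X) < k" using card_image_le le_less_trans by blast
    then have "\<not> {..<k} \<subseteq> col' ` ?X"
      using card_mono[of "col' ` ?X" "{..<k}"] \<open>finite ?X\<close> by auto
    then obtain c where c: "c < k" "c \<notin> col' ` ?X" by blast
    have b: "b \<notin> A \<union> B" using False insert by blast
    have "proper_coloring R k (A \<union> insert b B) (col'(b := c))"
      unfolding proper_coloring_def
    proof (intro conjI ballI impI)
      show "(col'(b := c)) ` (A \<union> insert b B) \<subseteq> {..<k}"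
        using col' c(1) by (auto simp: proper_coloring_def)
      fix e f assume ef: "e \<in> A \<union> insert b B" "f \<in> A \<union> insert b B" "R e f"
      have "R f e" using ef(3) R(1) by (meson sympD)
      have "e \<noteq> f" using ef(3) R(2) by (meson irreflpD)
      consider "e = b" "f \<in> A \<union> B" | "f = b" "e \<in> A \<union> B" | "e \<in> A \<union> B" "f \<in> A \<union> B"
        using ef \<open>e \<noteq> f\<close> by blast
      then show "(col'(b := c)) e \<noteq> (col'(b := c)) f"
      proof cases
        case 1
        then have "f \<noteq> b" "col' f \<in> col' ` ?X" using b ef(3) by auto
        then show ?thesis using 1 c by auto
      next
        case 2
        then have "e \<noteq> b" "col' e \<in> col' ` ?X" using b \<open>R f e\<close> by auto
        then show ?thesis using 2 c by auto
      next
        case 3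
        then have "e \<noteq> b" "f \<noteq> b" using b by auto
        then show ?thesis using col' 3 ef(3) by (simp add: proper_coloring_def)
      qed
    qed
    then show ?thesis by blast
  qed
qed

lemma symp_conflict: "symp (conflict E)"
  and irreflp_conflict: "irreflp (conflict E)"
  by (auto simp: symp_def irreflp_def conflict_def)

lemma sum_le_of_classes:
  fixes g :: "'a \<Rightarrow> nat"
  assumes "finite X" "\<And>w. w \<in> X \<Longrightarrow> g w \<le> (if P w then 1 else if Q w then 2 else D)"
  shows "sum g X \<le> card {w \<in> X. P w} + 2 * card {w \<in> X. \<not> P w \<and> Q w} + card {w \<in> X. \<not> P w \<and> \<not> Q w} * D"
proof -
  have "sum g X \<le> (\<Sum>w\<in>X. (if P w then 1 else 0) + ((if \<not> P w \<and> Q w then 2 else 0) + (if \<not> P w \<and> \<not> Q w then D else 0)))"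
    using assms(2) by (intro sum_mono) fastforce
  also have "\<dots> = card {w \<in> X. P w} + 2 * card {w \<in> X. \<not> P w \<and> Q w} + card {w \<in> X. \<not> P w \<and> \<not> Q w} * D"
    using assms(1) by (simp add: sum.distrib sum.If_cases Int_def)
  finally show ?thesis .
qed

section \<open>Conflict counts and the extension of a coloring\<close>

locale edge_set =
  fixes E :: "'a set set"
  assumes finite_E: "finite E" and card_edge: "e \<in> E \<Longrightarrow> card e = 2"
begin

lemma edge_at: "e \<in> E \<Longrightarrow> v \<in> e \<Longrightarrow> \<exists>w. e = {v, w} \<and> w \<in> nbs E v \<and> w \<noteq> v"
  using card_edge[of e] by (auto simp: card_2_iff nbs_def insert_commute)

lemma nbs_sym: "w \<in> nbs E v \<longleftrightarrow> v \<in> nbs E w"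
  by (simp add: nbs_def insert_commute)

lemma finite_nbs: "finite (nbs E v)"
proof (rule finite_subset)
  show "nbs E v \<subseteq> \<Union>E" by (auto simp: nbs_def)
  show "finite (\<Union>E)" using finite_E card_edge by (intro finite_Union_edges)
qed

lemma card_nbs: "card (nbs E v) = vertex_degree E v"
proof -
  have "inj_on (\<lambda>w. {v, w}) (nbs E v)" by (auto simp: inj_on_def doubleton_eq_iff)
  moreover have "(\<lambda>w. {v, w}) ` nbs E v = {e \<in> E. v \<in> e}"
    using edge_at[of _ v] by (auto simp: nbs_def)
  ultimately show ?thesis unfolding vertex_degree_def by (metis card_image)
qed

text \<open>A conflicting edge contains a neighbor of \<open>u\<close> other than \<open>v\<close>,
  or a neighbor of \<open>v\<close> other than \<open>u\<close>. Neighbors are taken in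
  \<open>E\<close> but edges are counted in \<open>S\<close>, so that free edges can be left out of
  the count.\<close>

lemma card_conflicts_le:
  assumes S: "S \<subseteq> E"
  shows "card {f \<in> S. conflict E {u, v} f} \<le>
    (\<Sum>w\<in>nbs E u - {v}. vertex_degree S w) + (\<Sum>w\<in>nbs E v - {u}. vertex_degree S w)"
proof -
  let ?W = "\<lambda>u v. \<Union>w\<in>nbs E u - {v}. {f \<in> S. w \<in> f}"
  have "{f \<in> S. conflict E {u, v} f} \<subseteq> ?W u v \<union> ?W v u"
  proof
    fix f assume "f \<in> {f \<in> S. conflict E {u, v} f}"
    then obtain g where f: "f \<in> S" "f \<in> E" "f \<noteq> {u, v}"
      and g: "g \<in> E" "g \<inter> {u, v} \<noteq> {}" "g \<inter> f \<noteq> {}"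
      using S by (auto simp: conflict_def)
    show "f \<in> ?W u v \<union> ?W v u"
    proof (cases "u \<in> f \<or> v \<in> f")
      case True
      then show ?thesis
      proof
        assume "u \<in> f"
        then obtain w where w: "f = {u, w}" "w \<in> nbs E u" using edge_at f by blast
        then have "w \<in> nbs E u - {v}" "w \<in> f" using f(3) by auto
        then show ?thesis using f(1) by blast
      next
        assume "v \<in> f"
        then obtain w where w: "f = {v, w}" "w \<in> nbs E v" using edge_at f by blast
        then have "w \<in> nbs E v - {u}" "w \<in> f" using f(3) by auto
        then show ?thesis using f(1) by blast
      qed
    next
      case False
      obtain w where w: "w \<in> g" "w \<in> f" using g(3) by blast
      consider "u \<in> g" | "v \<in> g" using g(2) by blast
      then show ?thesis
      proof cases
        case 1
        then obtain x where "g = {u, x}" "x \<in> nbs E u" using edge_at g(1) by blast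
        then have "w \<in> nbs E u - {v}" using w False by auto
        then show ?thesis using f(1) w(2) by blast
      next
        case 2
        then obtain x where "g = {v, x}" "x \<in> nbs E v" using edge_at g(1) by blast
        then have "w \<in> nbs E v - {u}" using w False by auto
        then show ?thesis using f(1) w(2) by blast
      qed
    qed
  qed
  moreover have fin: "finite (nbs E x - Y)" for x Y using finite_nbs by blast
  moreover have finS: "finite {f \<in> S. w \<in> f}" for w using S finite_E finite_subset by fastforce
  then have "finite (?W x y)" for x y by (intro finite_UN_I[OF fin finS])
  ultimately have "card {f \<in> S. conflict E {u, v} f} \<le> card (?W u v \<union> ?W v u)"
    by (intro card_mono finite_UnI)
  also have "\<dots> \<le> card (?W u v) + card (?W v u)" by (rule card_Un_le)
  also have "\<dots> \<le> (\<Sum>w\<in>nbs E u - {v}. vertex_degree S w) + (\<Sum>w\<in>nbs E v - {u}. vertex_degree S w)"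
    unfolding vertex_degree_def by (intro add_mono card_UN_le fin)
  finally show ?thesis .
qed

definition free :: "nat \<Rightarrow> 'a set set" where
  "free k = {e \<in> E. card {f \<in> E. conflict E e f} < k}"

definition easy :: "nat \<Rightarrow> 'a set set" where
  "easy k = {e \<in> E. card {f \<in> E - free k. conflict E e f} < k}"

lemma free_subset_easy: "free k \<subseteq> easy k"
proof
  fix e assume e: "e \<in> free k"
  have "card {f \<in> E - free k. conflict E e f} \<le> card {f \<in> E. conflict E e f}"
    using finite_E by (intro card_mono) auto
  then show "e \<in> easy k" using e by (auto simp: free_def easy_def)
qed

lemma coloring_extend_vertex:
  assumes easy: "\<And>e. e \<in> E \<Longrightarrow> v \<in> e \<Longrightarrow> e \<in> easy k"
    and col: "proper_coloring (conflict {e \<in> E. v \<notin> e}) k {e \<in> E. v \<notin> e} col"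
  shows "\<exists>col. proper_coloring (conflict E) k E col"
proof -
  let ?E' = "{e \<in> E. v \<notin> e}"
  \<comment> \<open>Deleting the whole vertex loses no conflict: edges joined by an edge \<open>{v, w}\<close> share \<open>w\<close>.\<close>
  have "conflict ?E' e f" if "conflict E e f" "e \<in> ?E'" "f \<in> ?E'" for e f
  proof -
    obtain g where g: "g \<in> E" "g \<inter> e \<noteq> {}" "g \<inter> f \<noteq> {}" "e \<noteq> f"
      using \<open>conflict E e f\<close> by (auto simp: conflict_def)
    show ?thesis
    proof (cases "v \<in> g")
      case True
      then obtain w where "g = {v, w}" using edge_at g(1) by blast
      then have "w \<in> e" "w \<in> f" using g that by auto
      then show ?thesis using that(2) g(4) by (auto simp: conflict_def)
    next
      case False
      then show ?thesis using g by (auto simp: conflict_def)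
    qed
  qed
  \<comment> \<open>Free edges away from \<open>v\<close> lose their colors: an easy edge is only
    known to have few conflicts outside \<open>free k\<close>.\<close>
  then have "proper_coloring (conflict E) k (?E' - free k) col"
    using col unfolding proper_coloring_def by blast
  moreover have eq: "(?E' - free k) \<union> ({e \<in> E. v \<in> e} - free k) = E - free k" by blast
  moreover have "card {f \<in> E - free k. conflict E e f} < k" if "e \<in> {e \<in> E. v \<in> e} - free k" for e
    using easy[of e] that by (simp add: easy_def)
  ultimately have "\<exists>col1. proper_coloring (conflict E) k (E - free k) col1"
    using greedy_coloring[OF _ _ symp_conflict irreflp_conflict, of "?E' - free k" "{e \<in> E. v \<in> e} - free k" E k col]
      finite_E by simp
  then obtain col1 where col1: "proper_coloring (conflict E) k (E - free k) col1" ..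
  have "(E - free k) \<union> free k = E" by (auto simp: free_def)
  moreover have "finite (free k)" using finite_E by (simp add: free_def)
  moreover have "card {f \<in> E. conflict E e f} < k" if "e \<in> free k" for e
    using that by (simp add: free_def)
  ultimately show ?thesis
    using greedy_coloring[OF _ _ symp_conflict irreflp_conflict, of "E - free k" "free k" E k col1]
      finite_E col1 by simp
qed

end

section \<open>Discharging\<close>

text \<open>Replaces the product \<open>s * D\<close> by linear terms, so that linear arithmetic can
  finish the counts below.\<close>

lemma mult_cases_le_2:
  fixes s D :: nat
  assumes "s \<le> 2"
  shows "s = 0 \<and> s * D = 0 \<or> s = 1 \<and> s * D = D \<or> s = 2 \<and> s * D = 2 * D"
  using assms by (auto simp: le_Suc_eq numeral_2_eq_2)

text \<open>The graphs at which the induction step is stuck: every vertex lies on an edge that is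
  not easy. The aim is \<open>core_dense\<close>, which contradicts sparsity.\<close>

locale irreducible_graph = edge_set E for E :: "'a set set" +
  fixes D :: nat
  assumes nonempty: "E \<noteq> {}"
    and degree_le: "vertex_degree E v \<le> D"
    and hard: "v \<in> \<Union>E \<Longrightarrow> \<exists>e\<in>E. v \<in> e \<and> e \<notin> easy (3 * D + 6)"
begin

abbreviation d :: "'a \<Rightarrow> nat" where "d \<equiv> vertex_degree E"
abbreviation N :: "'a \<Rightarrow> 'a set" where "N \<equiv> nbs E"

definition leaves :: "'a \<Rightarrow> nat" where "leaves x = card {w \<in> N x. d w = 1}"
definition twos :: "'a \<Rightarrow> nat" where "twos x = card {w \<in> N x. d w = 2}"
definition bigs :: "'a \<Rightarrow> nat" where "bigs x = card {w \<in> N x. d w \<ge> 3}"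

text \<open>A weak vertex gives no charge, but its edges to vertices of degree 2 are free. Hence an edge
  from \<open>x\<close> to a bad vertex \<open>v\<close> of degree 2 only has to avoid few edges that are not free.\<close>

definition weak :: "'a \<Rightarrow> bool" where
  "weak y \<longleftrightarrow> d y = 2 \<or> d y = 3 \<or> (d y = 4 \<and> twos y \<ge> 3)"

definition bad :: "'a \<Rightarrow> bool" where "bad v \<longleftrightarrow> (\<exists>y\<in>N v. weak y)"

definition bads :: "'a \<Rightarrow> nat" where "bads x = card {w \<in> N x. d w = 2 \<and> bad w}"
definition goods :: "'a \<Rightarrow> nat" where "goods x = card {w \<in> N x. d w = 2 \<and> \<not> bad w}"

lemma degree_pos: "w \<in> N x \<Longrightarrow> d w > 0"
  by (rule vertex_degree_pos[OF finite_E]) (auto simp: nbs_def)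

lemma degree_split: "d x = leaves x + twos x + bigs x"
proof -
  have "d w = 1 \<or> d w = 2 \<or> d w \<ge> 3" if "w \<in> N x" for w
    using degree_pos[OF that] by linarith
  then have "N x = {w \<in> N x. d w = 1} \<union> {w \<in> N x. d w = 2} \<union> {w \<in> N x. d w \<ge> 3}"
    by blast
  then have "d x = card ({w \<in> N x. d w = 1} \<union> {w \<in> N x. d w = 2} \<union> {w \<in> N x. d w \<ge> 3})"
    using card_nbs[of x] by argo
  also have "\<dots> = leaves x + twos x + bigs x"
    unfolding leaves_def twos_def bigs_def using finite_nbs[of x]
    by (subst card_Un_disjoint; auto)+
  finally show ?thesis .
qed

lemma twos_split: "twos x = bads x + goods x"
proof -
  have "twos x = card ({w \<in> N x. d w = 2 \<and> bad w} \<union> {w \<in> N x. d w = 2 \<and> \<not> bad w})"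
    unfolding twos_def by (intro arg_cong[of _ _ card]) blast
  also have "\<dots> = bads x + goods x"
    unfolding bads_def goods_def using finite_nbs[of x] by (subst card_Un_disjoint) auto
  finally show ?thesis .
qed

lemma sum_degree_nbs: "(\<Sum>w\<in>N x. d w) \<le> leaves x + 2 * twos x + bigs x * D"
proof -
  have "(\<Sum>w\<in>N x. d w) \<le> card {w \<in> N x. d w = 1} + 2 * card {w \<in> N x. d w \<noteq> 1 \<and> d w = 2}
      + card {w \<in> N x. d w \<noteq> 1 \<and> d w \<noteq> 2} * D"
    by (rule sum_le_of_classes[OF finite_nbs]) (use degree_le in auto)
  moreover have "{w \<in> N x. d w \<noteq> 1 \<and> d w = 2} = {w \<in> N x. d w = 2}" by auto
  moreover have "{w \<in> N x. d w \<noteq> 1 \<and> d w \<noteq> 2} = {w \<in> N x. d w \<ge> 3}"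
    using degree_pos[of _ x] by fastforce
  ultimately show ?thesis unfolding leaves_def twos_def bigs_def by simp
qed

lemma sum_degree_nbs_remove: "v \<in> N x \<Longrightarrow> (\<Sum>w\<in>N x - {v}. d w) + d v \<le> leaves x + 2 * twos x + bigs x * D"
  using sum_degree_nbs[of x] sum.remove[OF finite_nbs, of v x d] by simp

lemma other_neighbor:
  assumes "d v = 2" "x \<in> N v"
  obtains y where "N v = {x, y}" "x \<noteq> y"
proof -
  have "card (N v) = 2" using assms(1) by (simp add: card_nbs)
  then obtain a b where ab: "N v = {a, b}" "a \<noteq> b" by (auto simp: card_2_iff)
  show thesis
  proof (cases "x = a")
    case True
    then show ?thesis using that[of b] ab by simp
  next
    case False
    then show ?thesis using that[of a] ab assms(2) by (simp add: insert_commute)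
  qed
qed

section \<open>Reducible configurations\<close>

lemma free_edgeI:
  assumes "v \<in> N x" "(\<Sum>w\<in>N x - {v}. d w) + (\<Sum>w\<in>N v - {x}. d w) < 3 * D + 6"
  shows "{x, v} \<in> free (3 * D + 6)"
proof -
  have "{x, v} \<in> E" using assms(1) by (simp add: nbs_def)
  then show ?thesis using card_conflicts_le[of E x v] assms(2) by (simp add: free_def)
qed

lemma hard_two:
  assumes "d v = 2" "N v = {x, y}"
  shows "{v, x} \<notin> easy (3 * D + 6) \<or> {v, y} \<notin> easy (3 * D + 6)"
proof -
  have "v \<in> \<Union>E" using assms(2) by (auto simp: nbs_def)
  then obtain e where e: "e \<in> E" "v \<in> e" "e \<notin> easy (3 * D + 6)" using hard by blast
  then obtain w where "e = {v, w}" "w \<in> N v" using edge_at by blast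
  then show ?thesis using e(3) assms(2) by auto
qed

text \<open>The edge from \<open>x\<close> to a leaf conflicts only with edges at the other
  neighbors of \<open>x\<close>, at most the left-hand side minus 1 for the leaf itself. If this is
  below 3 * D + 6, the edge is free, hence easy, and it is the only edge at the leaf.\<close>

lemma leaves_bound:
  assumes "leaves x \<ge> 1"
  shows "leaves x + 2 * twos x + bigs x * D \<ge> 3 * D + 7"
proof (rule ccontr)
  assume neg: "\<not> ?thesis"
  have "{w \<in> N x. d w = 1} \<noteq> {}" using assms unfolding leaves_def by (metis card.empty not_one_le_zero)
  then obtain w where w: "w \<in> N x" "d w = 1" by blast
  have "card (N w) = 1" using w(2) by (simp add: card_nbs)
  moreover have "x \<in> N w" using w(1) by (simp add: nbs_def insert_commute)
  ultimately have Nw: "N w = {x}" by (metis card_1_singletonE singletonD)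
  have "{x, w} \<in> free (3 * D + 6)"
    using sum_degree_nbs_remove[OF w(1)] w Nw neg by (intro free_edgeI) auto
  then have easy: "{x, w} \<in> easy (3 * D + 6)" using free_subset_easy by blast
  have "w \<in> \<Union>E" using w(1) by (auto simp: nbs_def)
  then obtain e where e: "e \<in> E" "w \<in> e" "e \<notin> easy (3 * D + 6)" using hard by blast
  then obtain u where "e = {w, u}" "u \<in> N w" using edge_at by blast
  then have "e = {x, w}" using Nw by auto
  then show False using easy e by simp
qed

text \<open>Since \<open>d x \<le> D\<close>, the sum in \<open>leaves_bound\<close> is at most D +
  twos x + bigs x * (D - 1). For two big neighbors and eight of degree 2 this is 3 * D + 6, just
  below the required 3 * D + 7; hence the 8.\<close>

lemma no_leaves:
  assumes "bigs x \<le> 2" "twos x \<le> 8"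
  shows "leaves x = 0"
proof (rule ccontr)
  assume "leaves x \<noteq> 0"
  then have "leaves x + 2 * twos x + bigs x * D \<ge> 3 * D + 7" by (intro leaves_bound) simp
  moreover have "leaves x + twos x + bigs x \<le> D" using degree_le[of x] degree_split[of x] by simp
  ultimately show False using assms(2) mult_cases_le_2[OF assms(1), of D] by (elim disjE conjE) linarith+
qed

text \<open>\<open>twos x + bigs x\<close> is the degree of \<open>x\<close> after the deletion of
  the leaves. If it were below 2, then \<open>no_leaves\<close> would make it equal to
  \<open>d x\<close>.\<close>

lemma core_degree_ge_2:
  assumes "d x \<ge> 2" shows "twos x + bigs x \<ge> 2"
proof (rule ccontr)
  assume "\<not> ?thesis"
  then show False using no_leaves[of x] assms degree_split[of x] by simp
qed

lemma degree_eq_2: "twos x + bigs x = 2 \<Longrightarrow> d x = 2"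
  using no_leaves[of x] degree_split[of x] by simp

lemma degree_eq_2D: "d x = 2 \<Longrightarrow> leaves x = 0 \<and> twos x + bigs x = 2"
  using core_degree_ge_2[of x] degree_split[of x] by simp

text \<open>The other neighbor of \<open>v\<close> contributes at most D conflicts. Since
  \<open>v\<close> itself has degree 2, \<open>y\<close> has at most two big neighbors, and its side
  contributes at most 2 * D + 5.\<close>

lemma weak_edge_free:
  assumes "weak y" "v \<in> N y" "d v = 2"
  shows "{y, v} \<in> free (3 * D + 6)"
proof -
  have "y \<in> N v" using assms(2) by (simp add: nbs_def insert_commute)
  then obtain x where x: "N v = {y, x}" "y \<noteq> x" using other_neighbor[OF assms(3)] by blast
  then have "N v - {y} = {x}" by auto
  then have 1: "(\<Sum>w\<in>N v - {y}. d w) \<le> D" using degree_le[of x] by simp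
  have 2: "(\<Sum>w\<in>N y - {v}. d w) + 2 \<le> leaves y + 2 * twos y + bigs y * D"
    using sum_degree_nbs_remove[OF assms(2)] assms(3) by simp
  have "v \<in> {w \<in> N y. d w = 2}" using assms by simp
  then have "twos y \<noteq> 0" unfolding twos_def using finite_nbs[of y] by auto
  then have b: "bigs y \<le> 2" and l: "leaves y + twos y + bigs y \<le> 4" and tb: "twos y \<ge> 3 \<or> leaves y + twos y + bigs y \<le> 3"
    using assms(1) degree_split[of y] by (auto simp: weak_def)
  have "D \<ge> 2" using degree_le[of v] assms(3) by simp
  then have 3: "(\<Sum>w\<in>N y - {v}. d w) \<le> 2 * D + 5"
    using 2 l tb mult_cases_le_2[OF b, of D] by (elim disjE conjE) linarith+
  show ?thesis
  proof (rule free_edgeI[OF assms(2)])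
    show "(\<Sum>w\<in>N y - {v}. d w) + (\<Sum>w\<in>N v - {y}. d w) < 3 * D + 6"
      using 1 3 by linarith
  qed
qed

text \<open>Otherwise both edges at \<open>v\<close> would be free. So every vertex of degree 2 has
  a neighbor that pays.\<close>

lemma not_both_weak:
  assumes "d v = 2" "N v = {x, y}"
  shows "\<not> (weak x \<and> weak y)"
proof
  assume w: "weak x \<and> weak y"
  have "v \<in> N x" "v \<in> N y" using assms(2) nbs_sym[of v] by simp_all
  then have "{x, v} \<in> free (3 * D + 6)" "{y, v} \<in> free (3 * D + 6)"
    using weak_edge_free w assms(1) by blast+
  then show False
    using hard_two[OF assms] free_subset_easy by (auto simp: insert_commute)
qed

text \<open>This is what lets \<open>x\<close> pay 1 to each bad and 1/2 to each good neighbor of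
  degree 2: twice its charge, 2 * (twos x + bigs x) - 6, minus twice its payments is 2 * bigs x +
  goods x - 6. If this were negative, the edge from \<open>x\<close> to a bad \<open>v\<close> would
  be easy: each bad neighbor, whose other edge is free, accounts for one edge instead of two, and
  the weak neighbor of \<open>v\<close> for at most three.\<close>

lemma bads_bound:
  assumes "bads x \<ge> 1" "\<not> weak x"
  shows "2 * bigs x + goods x \<ge> 6"
proof (rule ccontr)
  assume neg: "\<not> ?thesis"
  let ?k = "3 * D + 6" let ?S = "E - free ?k"
  have fS: "vertex_degree ?S w \<le> d w" for w
    unfolding vertex_degree_def using finite_E by (intro card_mono) auto
  have fS': "vertex_degree ?S w < d w" if "e \<in> free ?k" "w \<in> e" for w e
  proof -
    have "e \<in> E" using that(1) by (simp add: free_def)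
    then show ?thesis
      unfolding vertex_degree_def using finite_E that by (intro psubset_card_mono) auto
  qed
  have "{w \<in> N x. d w = 2 \<and> bad w} \<noteq> {}" using assms(1) unfolding bads_def by (metis card.empty not_one_le_zero)
  then obtain v where v: "v \<in> N x" "d v = 2" "bad v" by blast
  have "x \<in> N v" using v(1) by (simp add: nbs_def insert_commute)
  then obtain y where y: "N v = {x, y}" "x \<noteq> y" using other_neighbor[OF v(2)] by blast
  have wy: "weak y" using v(3) y assms(2) by (auto simp: bad_def)
  have vy: "v \<in> N y" using y(1) nbs_sym[of v y] by simp
  have free: "{y, v} \<in> free ?k" using weak_edge_free[OF wy vy v(2)] .
  then have "{v, y} \<in> easy ?k" using free_subset_easy by (auto simp: insert_commute)
  then have hardx: "{x, v} \<notin> easy ?k" using hard_two[OF v(2) y(1)] by (simp add: insert_commute)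
  have "{x, v} \<in> E" using v(1) by (simp add: nbs_def)
  then have ge: "?k \<le> (\<Sum>w\<in>N x - {v}. vertex_degree ?S w) + (\<Sum>w\<in>N v - {x}. vertex_degree ?S w)"
    using hardx card_conflicts_le[of ?S x v] by (simp add: easy_def)
  have "N v - {x} = {y}" using y by auto
  moreover have "vertex_degree ?S y < d y" using fS'[OF free] by simp
  moreover have "d y \<le> 4" using wy by (auto simp: weak_def)
  ultimately have 1: "(\<Sum>w\<in>N v - {x}. vertex_degree ?S w) \<le> 3" by simp
  \<comment> \<open>\<open>P\<close> collects the neighbors with at most one edge that is not
    free.\<close>
  define P where "P = (\<lambda>w. d w = 1 \<or> (d w = 2 \<and> bad w))"
  have "(\<Sum>w\<in>N x - {v}. vertex_degree ?S w) \<le> card {w \<in> N x - {v}. P w}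
      + 2 * card {w \<in> N x - {v}. \<not> P w \<and> d w = 2} + card {w \<in> N x - {v}. \<not> P w \<and> d w \<noteq> 2} * D"
  proof (rule sum_le_of_classes)
    show "finite (N x - {v})" using finite_nbs by blast
    fix w assume w: "w \<in> N x - {v}"
    show "vertex_degree ?S w \<le> (if P w then 1 else if d w = 2 then 2 else D)"
    proof (cases "d w = 2 \<and> bad w")
      case True
      have "x \<in> N w" using w by (simp add: nbs_def insert_commute)
      then obtain z where z: "N w = {x, z}" using other_neighbor True by blast
      then have "weak z" using True assms(2) by (auto simp: bad_def)
      moreover have "w \<in> N z" using z nbs_sym[of w z] by simp
      ultimately have "{z, w} \<in> free ?k" using weak_edge_free True by blast
      then have "vertex_degree ?S w < 2" using fS'[of "{z, w}" w] True by simp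
      then show ?thesis using True by (simp add: P_def)
    next
      case False
      then show ?thesis using fS[of w] degree_le[of w] by (auto simp: P_def)
    qed
  qed
  also have "{w \<in> N x - {v}. P w} = {w \<in> N x. P w} - {v}" by blast
  also have "card ({w \<in> N x. P w} - {v}) = leaves x + bads x - 1"
  proof -
    have "{w \<in> N x. P w} = {w \<in> N x. d w = 1} \<union> {w \<in> N x. d w = 2 \<and> bad w}"
      by (auto simp: P_def)
    then have "card {w \<in> N x. P w} = leaves x + bads x"
      unfolding leaves_def bads_def using finite_nbs[of x] by (simp, subst card_Un_disjoint) auto
    moreover have "v \<in> {w \<in> N x. P w}" using v by (simp add: P_def)
    ultimately show ?thesis by simp
  qed
  also have "{w \<in> N x - {v}. \<not> P w \<and> d w = 2} = {w \<in> N x. d w = 2 \<and> \<not> bad w}"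
    using v by (auto simp: P_def)
  also have "card {w \<in> N x. d w = 2 \<and> \<not> bad w} = goods x" by (simp add: goods_def)
  also have "{w \<in> N x - {v}. \<not> P w \<and> d w \<noteq> 2} = {w \<in> N x. d w \<ge> 3}"
    using v degree_pos[of _ x] by (fastforce simp: P_def)
  also have "card {w \<in> N x. d w \<ge> 3} = bigs x" by (simp add: bigs_def)
  finally have "?k \<le> leaves x + bads x - 1 + 2 * goods x + bigs x * D + 3" using ge 1 by linarith
  moreover have "leaves x + bads x + goods x + bigs x \<le> D"
    using degree_le[of x] degree_split[of x] twos_split[of x] by simp
  \<comment> \<open>In the three cases \<open>goods x\<close> is at most 5, 3, 1 and the count at
    most D + 7, 2 * D + 4, 3 * D + 1, each below 3 * D + 6 as D \<ge> 1.\<close>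
  moreover have "bigs x = 0 \<and> bigs x * D = 0 \<or> bigs x = 1 \<and> bigs x * D = D \<or> bigs x = 2 \<and> bigs x * D = 2 * D"
    by (rule mult_cases_le_2) (use neg in simp)
  ultimately show False using neg assms(1) by (elim disjE conjE) linarith+
qed

text \<open>Such a vertex does not occur: without big neighbors it has no leaves either, so each of
  its edges has at most (2 * D - 2) + D conflicts and is free. The conclusion is the form in which
  \<open>nonweak_bound\<close> treats this case.\<close>

lemma bigs_0_bound:
  assumes "d x \<ge> 2" "bigs x = 0"
  shows "bads x \<ge> 1"
proof (rule ccontr)
  assume neg: "\<not> ?thesis"
  have l: "leaves x = 0"
  proof (rule ccontr)
    assume "leaves x \<noteq> 0"
    then have "leaves x + 2 * twos x + bigs x * D \<ge> 3 * D + 7" by (intro leaves_bound) simp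
    then show False using assms(2) degree_le[of x] degree_split[of x] by simp
  qed
  have easy: "{x, v} \<in> easy (3 * D + 6)" if v: "v \<in> N x" for v
  proof -
    have "v \<notin> {w \<in> N x. d w = 1}" "v \<notin> {w \<in> N x. d w \<ge> 3}"
      using l assms(2) finite_nbs[of x] unfolding leaves_def bigs_def by auto
    then have dv: "d v = 2" using v degree_pos[OF v] by simp
    have "x \<in> N v" using v by (simp add: nbs_def insert_commute)
    then obtain y where y: "N v = {x, y}" "x \<noteq> y" using other_neighbor[OF dv] by blast
    then have "N v - {x} = {y}" by auto
    then have "(\<Sum>w\<in>N v - {x}. d w) \<le> D" using degree_le[of y] by simp
    moreover have "(\<Sum>w\<in>N x - {v}. d w) + 2 \<le> 2 * D"
      using sum_degree_nbs_remove[OF v] dv l assms(2) degree_le[of x] degree_split[of x] by simp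
    ultimately have "{x, v} \<in> free (3 * D + 6)" by (intro free_edgeI[OF v]) linarith
    then show ?thesis using free_subset_easy by blast
  qed
  have "N x \<noteq> {}" using assms(1) card_nbs[of x] by auto
  then have "x \<in> \<Union>E" by (auto simp: nbs_def)
  then obtain e where e: "e \<in> E" "x \<in> e" "e \<notin> easy (3 * D + 6)" using hard by blast
  then obtain w where "e = {x, w}" "w \<in> N x" using edge_at by blast
  then show False using easy e(3) by blast
qed

text \<open>Twice the payments of \<open>x\<close> stay within twice its charge. The thresholds in
  \<open>weak\<close> are made for the case of a big neighbor and no bad one: there 2 * bigs x +
  twos x \<le> 5 leaves five pairs of counts, and all of them make \<open>x\<close> weak.\<close>

lemma nonweak_bound:
  assumes "d x \<ge> 2" "\<not> weak x"
  shows "2 * bads x + goods x + 6 \<le> 2 * (twos x + bigs x)"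
proof -
  have "2 * bigs x + goods x \<ge> 6"
  proof (cases "bads x \<ge> 1 \<or> bigs x = 0")
    case True
    then show ?thesis using bads_bound bigs_0_bound assms by blast
  next
    case False
    show ?thesis
    proof (rule ccontr)
      assume neg: "\<not> ?thesis"
      then have "leaves x = 0"
        using False twos_split[of x] by (intro no_leaves) auto
      moreover have "twos x + bigs x \<ge> 2" using core_degree_ge_2[OF assms(1)] .
      moreover have "goods x = twos x" using False twos_split[of x] by simp
      ultimately have dx: "d x = twos x + bigs x" and "2 * bigs x + twos x \<le> 5" "bigs x \<ge> 1" "twos x + bigs x \<ge> 2"
        using neg False degree_split[of x] by simp_all
      then have "bigs x = 1 \<and> (twos x = 1 \<or> twos x = 2 \<or> twos x = 3) \<or> bigs x = 2 \<and> (twos x = 0 \<or> twos x = 1)"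
        by linarith
      then have "weak x" using dx by (elim disjE conjE) (simp_all add: weak_def)
      then show False using assms(2) by blast
    qed
  qed
  then show ?thesis using twos_split[of x] by simp
qed

section \<open>The graph without its leaves\<close>

lemma core_nonempty: "{v. d v \<ge> 2} \<noteq> {}"
proof -
  obtain e where e: "e \<in> E" using nonempty by blast
  obtain a b where ab: "e = {a, b}" using card_edge[OF e] by (auto simp: card_2_iff)
  then have b: "b \<in> N a" using e by (simp add: nbs_def)
  show ?thesis
  proof (cases "d b \<ge> 2")
    case False
    then have "b \<in> {w \<in> N a. d w = 1}" using b degree_pos[OF b] by simp
    then have "leaves a \<noteq> 0" unfolding leaves_def using finite_nbs[of a] by auto
    \<comment> \<open>A vertex with a leaf has at least three big neighbors or nine of degree 2, so
      it survives the deletion.\<close>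
    then have "\<not> bigs a \<le> 2 \<or> \<not> twos a \<le> 8" using no_leaves[of a] by argo
    then have "bigs a + twos a \<ge> 2" by (elim disjE) simp_all
    then have "a \<in> {v. d v \<ge> 2}" using degree_split[of a] by simp
    then show ?thesis by (metis empty_iff)
  next
    case True
    then have "b \<in> {v. d v \<ge> 2}" by simp
    then show ?thesis by (metis empty_iff)
  qed
qed

lemma core_dense: "3 * card {v. d v \<ge> 2} \<le> 2 * card {e \<in> E. e \<subseteq> {v. d v \<ge> 2}}"
proof -
  define H where "H = {v. d v \<ge> 2}"
  define T where "T = {v. d v = 2}"
  let ?F = "{e \<in> E. e \<subseteq> H}"
  have TH: "T \<subseteq> H" by (auto simp: H_def T_def)
  have "H \<subseteq> \<Union>E"
  proof
    fix v assume "v \<in> H"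
    then have "{e \<in> E. v \<in> e} \<noteq> {}" unfolding H_def vertex_degree_def by (metis (lifting) card.empty mem_Collect_eq not_numeral_le_zero)
    then show "v \<in> \<Union>E" by blast
  qed
  moreover have "finite (\<Union>E)" using finite_E card_edge by (intro finite_Union_edges)
  ultimately have finH: "finite H" by (rule finite_subset)
  then have finT: "finite T" using TH finite_subset by blast
  have edges: "(\<Sum>x\<in>H. twos x + bigs x) = 2 * card ?F"
  proof -
    have F: "edge_set ?F" using finite_E card_edge by unfold_locales auto
    have "vertex_degree ?F x = twos x + bigs x" if "x \<in> H" for x
    proof -
      have "vertex_degree ?F x = card (nbs ?F x)" using edge_set.card_nbs[OF F] by simp
      also have "nbs ?F x = {w \<in> N x. d w = 2} \<union> {w \<in> N x. d w \<ge> 3}"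
        using that by (auto simp: nbs_def H_def)
      also have "card \<dots> = twos x + bigs x"
        unfolding twos_def bigs_def using finite_nbs[of x] by (subst card_Un_disjoint) auto
      finally show ?thesis .
    qed
    then have "(\<Sum>x\<in>H. twos x + bigs x) = (\<Sum>x\<in>H. vertex_degree ?F x)" by simp
    also have "\<dots> = 2 * card ?F"
      using finite_E card_edge finH by (intro handshake) auto
    finally show ?thesis .
  qed
  \<comment> \<open>Twice the charge that \<open>x\<close> gives to a neighbor \<open>v\<close> of degree 2; the initial charge of a vertex
    of \<open>H\<close> is its degree in \<open>H\<close> minus 3.\<close>
  define ch where "ch = (\<lambda>x v. if weak x then 0 else if bad v then 2 else (1::nat))"
  \<comment> \<open>Twice the statement that no final charge is negative: 6 is twice the 3 of the
    initial charge, and the last summand is twice what a vertex of degree 2 has to receive.\<close>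
  have give: "6 + (\<Sum>v\<in>N x \<inter> T. ch x v) \<le> 2 * (twos x + bigs x) + (if x \<in> T then 2 else 0)"
    if x: "x \<in> H" for x
  proof (cases "weak x")
    case True
    then have 0: "(\<Sum>v\<in>N x \<inter> T. ch x v) = 0" by (simp add: ch_def)
    show ?thesis
    proof (cases "x \<in> T")
      case True
      then have "twos x + bigs x = 2" using degree_eq_2D by (simp add: T_def)
      then show ?thesis using 0 True by simp
    next
      case False
      then have "twos x + bigs x \<noteq> 2" using degree_eq_2 by (auto simp: T_def)
      then show ?thesis using 0 core_degree_ge_2[of x] x by (simp add: H_def)
    qed
  next
    case False
    have "(\<Sum>v\<in>N x \<inter> T. ch x v) = (\<Sum>v\<in>N x \<inter> T. (if bad v then 2 else 0) + (if bad v then 0 else 1))"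
      using False by (intro sum.cong) (auto simp: ch_def)
    also have "\<dots> = 2 * card {v \<in> N x \<inter> T. bad v} + card {v \<in> N x \<inter> T. \<not> bad v}"
      using finite_nbs[of x] by (simp add: sum.distrib sum.If_cases Int_def)
    also have "{v \<in> N x \<inter> T. bad v} = {w \<in> N x. d w = 2 \<and> bad w}" by (auto simp: T_def)
    also have "{v \<in> N x \<inter> T. \<not> bad v} = {w \<in> N x. d w = 2 \<and> \<not> bad w}" by (auto simp: T_def)
    finally have "(\<Sum>v\<in>N x \<inter> T. ch x v) = 2 * bads x + goods x" by (simp add: bads_def goods_def)
    then show ?thesis using nonweak_bound[of x] x False by (simp add: H_def)
  qed
  \<comment> \<open>If one neighbor is weak, then \<open>v\<close> is bad and the other neighbor
    pays 2; otherwise each pays 1.\<close>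
  have receive: "2 \<le> (\<Sum>x\<in>N v. ch x v)" if v: "v \<in> T" for v
  proof -
    have dv: "d v = 2" using v by (simp add: T_def)
    then have "card (N v) = 2" by (simp add: card_nbs)
    then obtain x y where xy: "N v = {x, y}" "x \<noteq> y" by (auto simp: card_2_iff)
    then have "(\<Sum>x\<in>N v. ch x v) = ch x v + ch y v" by simp
    moreover have "\<not> (weak x \<and> weak y)" by (rule not_both_weak[OF dv xy(1)])
    moreover have "bad v \<longleftrightarrow> weak x \<or> weak y" using xy(1) by (auto simp: bad_def)
    ultimately show ?thesis by (auto simp: ch_def)
  qed
  \<comment> \<open>A vertex of degree 2 has no leaf as a neighbor, so all that pay to it belong to
    \<open>H\<close> and the double sum can be exchanged.\<close>
  have NH: "N v \<subseteq> H" if v: "v \<in> T" for v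
  proof
    fix x assume x: "x \<in> N v"
    have "leaves v = 0" using degree_eq_2D v by (simp add: T_def)
    then have "x \<notin> {w \<in> N v. d w = 1}" unfolding leaves_def using finite_nbs[of v] by auto
    then show "x \<in> H" using x degree_pos[OF x] by (simp add: H_def)
  qed
  have "2 * card T \<le> (\<Sum>v\<in>T. \<Sum>x\<in>N v. ch x v)"
    using sum_mono[OF receive, of T "\<lambda>v. v"] by simp
  also have "\<dots> = (\<Sum>v\<in>T. \<Sum>x\<in>H. if x \<in> N v then ch x v else 0)"
  proof (rule sum.cong[OF refl])
    fix v assume "v \<in> T"
    then have "{x \<in> H. x \<in> N v} = N v" using NH by blast
    then show "(\<Sum>x\<in>N v. ch x v) = (\<Sum>x\<in>H. if x \<in> N v then ch x v else 0)"
      using sum.inter_filter[OF finH, of "\<lambda>x. ch x v" "\<lambda>x. x \<in> N v"] by simp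
  qed
  also have "\<dots> = (\<Sum>x\<in>H. \<Sum>v\<in>T. if v \<in> N x then ch x v else 0)"
    by (subst sum.swap) (simp add: nbs_sym)
  also have "\<dots> = (\<Sum>x\<in>H. \<Sum>v\<in>N x \<inter> T. ch x v)"
  proof (rule sum.cong[OF refl])
    fix x
    have "{v \<in> T. v \<in> N x} = N x \<inter> T" by blast
    then show "(\<Sum>v\<in>T. if v \<in> N x then ch x v else 0) = (\<Sum>v\<in>N x \<inter> T. ch x v)"
      using sum.inter_filter[OF finT, of "\<lambda>v. ch x v" "\<lambda>v. v \<in> N x"] by simp
  qed
  finally have A: "2 * card T \<le> (\<Sum>x\<in>H. \<Sum>v\<in>N x \<inter> T. ch x v)" .
  have "(\<Sum>x\<in>H. 6 + (\<Sum>v\<in>N x \<inter> T. ch x v)) \<le> (\<Sum>x\<in>H. 2 * (twos x + bigs x) + (if x \<in> T then 2 else 0))"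
    by (rule sum_mono) (rule give)
  then have "6 * card H + (\<Sum>x\<in>H. \<Sum>v\<in>N x \<inter> T. ch x v) \<le> 2 * (\<Sum>x\<in>H. twos x + bigs x) + (\<Sum>x\<in>H. if x \<in> T then 2 else 0)"
    by (simp add: sum.distrib sum_distrib_left algebra_simps)
  moreover have "(\<Sum>x\<in>H. if x \<in> T then 2 else (0::nat)) = 2 * card T"
  proof -
    have "{x \<in> H. x \<in> T} = T" using TH by blast
    then show ?thesis using sum.inter_filter[OF finH, of "\<lambda>_. 2::nat" "\<lambda>x. x \<in> T"] by simp
  qed
  ultimately have "6 * card H \<le> 2 * (2 * card ?F)" using A edges by linarith
  then show ?thesis unfolding H_def by simp
qed

end

text \<open>\<open>D\<close> is only an upper bound for the degrees, and sparsity is asked only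
  inside \<open>\<Union>E\<close>. In this form both pass to the graph without \<open>v\<close>
  while the number of colors stays the same.\<close>

lemma sparse_graph_coloring:
  assumes "edge_set E" "\<And>v. vertex_degree E v \<le> D"
    and "\<And>W. W \<subseteq> \<Union>E \<Longrightarrow> W \<noteq> {} \<Longrightarrow> 2 * card {e \<in> E. e \<subseteq> W} < 3 * card W"
  shows "\<exists>col. proper_coloring (conflict E) (3 * D + 6) E col"
proof -
  have "finite E" using assms(1) by (rule edge_set.finite_E)
  then show ?thesis
    using assms
  proof (induction E rule: finite_psubset_induct)
    case (psubset E)
    interpret edge_set E by fact
    show ?case
    proof (cases "E = {}")
      case True
      then show ?thesis by (simp add: proper_coloring_def)
    next
      case False
      have "\<exists>v\<in>\<Union>E. \<forall>e\<in>E. v \<in> e \<longrightarrow> e \<in> easy (3 * D + 6)"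
      proof (rule ccontr)
        assume neg: "\<not> ?thesis"
        interpret irreducible_graph E D
          using False psubset.prems(2) neg by unfold_locales blast+
        have "{v. vertex_degree E v \<ge> 2} \<subseteq> \<Union>E"
        proof
          fix v assume "v \<in> {v. vertex_degree E v \<ge> 2}"
          then have "{e \<in> E. v \<in> e} \<noteq> {}" unfolding vertex_degree_def by (metis (lifting) card.empty mem_Collect_eq not_numeral_le_zero)
          then show "v \<in> \<Union>E" by blast
        qed
        then show False using psubset.prems(3)[OF _ core_nonempty] core_dense by fastforce
      qed
      then obtain v where v: "v \<in> \<Union>E" "\<And>e. e \<in> E \<Longrightarrow> v \<in> e \<Longrightarrow> e \<in> easy (3 * D + 6)" by blast
      let ?E = "{e \<in> E. v \<notin> e}"
      have "\<exists>col. proper_coloring (conflict ?E) (3 * D + 6) ?E col"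
      proof (rule psubset.IH)
        show "?E \<subset> E" using v(1) by blast
        show "edge_set ?E" using finite_E card_edge by unfold_locales auto
        show "vertex_degree ?E u \<le> D" for u
        proof -
          have "vertex_degree ?E u \<le> vertex_degree E u"
            unfolding vertex_degree_def using finite_E by (intro card_mono) auto
          then show ?thesis using psubset.prems(2)[of u] by simp
        qed
        fix W assume W: "W \<subseteq> \<Union>?E" "W \<noteq> {}"
        have "2 * card {e \<in> ?E. e \<subseteq> W} \<le> 2 * card {e \<in> E. e \<subseteq> W}"
          using finite_E by (intro mult_le_mono2 card_mono) auto
        also have "\<dots> < 3 * card W" using W by (intro psubset.prems(3)) auto
        finally show "2 * card {e \<in> ?E. e \<subseteq> W} < 3 * card W" .
      qed
      then show ?thesis using coloring_extend_vertex[OF v(2)] by blast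
    qed
  qed
qed

section \<open>From distance in the line graph to conflicts\<close>

lemma edge_dist_le_2_conflict:
  assumes "e \<in> E" "f \<in> E" "e \<noteq> f" "edge_dist E e f \<le> 2"
  shows "conflict E e f"
proof -
  let ?S = "{enat (length p - 1) |p. is_walk E (line_edges E) e p f}"
  have "Inf ?S \<le> 2" using assms(4) by (simp add: edge_dist_def graph_dist_def)
  moreover have "?S \<noteq> {}"
  proof
    assume "?S = {}"
    then have "Inf ?S = \<infinity>" by (simp add: Inf_enat_def)
    then show False using calculation by simp
  qed
  \<comment> \<open>A nonempty set of extended naturals contains its infimum.\<close>
  ultimately have "\<exists>n\<in>?S. n \<le> 2"
    by (metis (no_types, lifting) Inf_enat_def LeastI_ex ex_in_conv)
  then obtain p where p: "is_walk E (line_edges E) e p f" and "enat (length p - 1) \<le> 2" by blast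
  then have len: "length p \<le> 3" by (simp add: numeral_eq_enat)
  have le: "x \<inter> y \<noteq> {} \<and> x \<in> E \<and> y \<in> E" if "{x, y} \<in> line_edges E" for x y
    using that unfolding line_edges_def by (auto simp: doubleton_eq_iff)
  have pn: "p \<noteq> []" "hd p = e" "last p = f" "successively (\<lambda>x y. {x, y} \<in> line_edges E) p"
    using p by (auto simp: is_walk_def)
  have "length p \<noteq> 0" using pn(1) by simp
  with len consider "length p = 1" | "length p = 2" | "length p = 3" by linarith
  then show ?thesis
  proof cases
    case 1
    then show ?thesis using pn assms(3) by (auto simp: length_Suc_conv)
  next
    case 2
    then have "p = [e, f]" using pn by (auto simp: numeral_eq_Suc length_Suc_conv)
    then have "e \<inter> f \<noteq> {}" using pn(4) le by auto
    then show ?thesis unfolding conflict_def using assms by blast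
  next
    case 3
    then obtain g where "p = [e, g, f]" using pn by (auto simp: numeral_eq_Suc length_Suc_conv)
    then have "{e, g} \<in> line_edges E" "{g, f} \<in> line_edges E" using pn(4) by auto
    from le[OF this(1)] le[OF this(2)] show ?thesis unfolding conflict_def using assms by blast
  qed
qed

theorem theorem7:
  fixes V :: "'a set" and E :: "'a set set"
  assumes "simple_graph V E"
    and "planar V E"
    and "girth V E \<ge> 6"
    and "max_degree V E \<ge> 4"
  shows "strong_chromatic_index E \<le> 3 * max_degree V E + 6"
proof -
  let ?D = "max_degree V E"
  have V: "finite V" "\<And>e. e \<in> E \<Longrightarrow> e \<subseteq> V" "\<And>e. e \<in> E \<Longrightarrow> card e = 2"
    using assms(1) by (auto simp: simple_graph_def)
  have "E \<subseteq> Pow V" using V(2) by blast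
  then have finE: "finite E" using V(1) finite_subset by auto
  \<comment> \<open>The bound is wanted for every element of the type; outside \<open>V\<close> the
    degree is 0.\<close>
  have deg: "vertex_degree E v \<le> ?D" for v
  proof (cases "v \<in> V")
    case True
    then show ?thesis unfolding max_degree_def using V(1) by (intro Max_ge) auto
  next
    case False
    then have none: "{e \<in> E. v \<in> e} = {}" using V(2) by blast
    show ?thesis unfolding vertex_degree_def none by simp
  qed
  have "\<exists>col. proper_coloring (conflict E) (3 * ?D + 6) E col"
  proof (rule sparse_graph_coloring)
    show "edge_set E" using finE V(3) by unfold_locales
    show "vertex_degree E v \<le> ?D" for v by (rule deg)
    fix W assume "W \<subseteq> \<Union>E" "W \<noteq> {}"
    then show "2 * card {e \<in> E. e \<subseteq> W} < 3 * card W"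
      using V(2) by (intro planar_girth_6_sparse[OF assms(1-3)]) blast+
  qed
  then obtain col where col: "proper_coloring (conflict E) (3 * ?D + 6) E col" ..
  then have "strong_edge_coloring E col"
    using edge_dist_le_2_conflict unfolding strong_edge_coloring_def proper_coloring_def by blast
  moreover have "col ` E \<subseteq> {..<3 * ?D + 6}" using col by (simp add: proper_coloring_def)
  ultimately show ?thesis
    unfolding strong_chromatic_index_def by (intro Least_le) blast
qed

end
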